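(* Let $E$ be an arbitrary directed graph, and let $K$ be any field. Then the Leavitt path algebra $L_K(E)$ is a prime ring if and only if $E$ satisfies Condition (MT3).
   Context: A (directed) graph $E=(E^0,E^1,r,s)$ consists of two sets $E^0$ (vertices), $E^1$ (edges), of arbitrary cardinality, and functions $r,s:E^1\to E^0$ (range and source). A path is a finite sequence of edges $\mu=e_1\cdots e_n$ with $r(e_i)=s(e_{i+1})$ for $1\le i\le n-1$; $s(\mu)=s(e_1)$, $r(\mu)=r(e_n)$; vertices are regarded as paths of length $0$. For vertices $u,v$, write $u\ge v$ if there is a path $p$ (possibly of length $0$) with $s(p)=u$, $r(p)=v$. Condition (MT3): for every pair of vertices $v,w\in E^0$ there is a vertex $u\in E^0$ with $v\ge u$ and $w\ge u$. The Leavitt path algebra $L_K(E)$ is the (associative, not necessarily unital) $K$-algebra generated by the set $\{v\mid v\in E^0\}\cup\{e,e^*\mid e\in E^1\}$ subject to the relations: (V) $vw=\delta_{v,w}v$ for $v,w\in E^0$; (E1) $s(e)e=er(e)=e$ for $e\in E^1$; (E2) $r(e)e^*=e^*s(e)=e^*$ for $e\in E^1$; (CK1) $e^*e'=\delta_{e,e'}r(e)$ for $e,e'\in E^1$; (CK2) $v=\sum_{\{e\in E^1\mid s(e)=v\}}ee^*$ for every vertex $v$ with $1\le|s^{-1}(v)|<\infty$. A ring $R$ (possibly nonunital) is prime if the product of any two nonzero two-sided ideals of $R$ is nonzero. *)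

theory Defs
  imports
    "HOL-Algebra.QuotRing"
    "HOL-Algebra.Ideal_Product"
    "HOL-Library.Poly_Mapping"
    "Graph_Theory.Arc_Walk"
begin

section \<open>Nonunital rings, two-sided ideals and primeness\<close>

text \<open>
  The locale \<^locale>\<open>ring\<close> is unital, and so are the ideals built on it.  The \<open>one\<close> field of
  the record is never inspected below.
\<close>

locale nonunital_ring = abelian_group R for R (structure) +
  assumes mult_closed: "\<lbrakk>x \<in> carrier R; y \<in> carrier R\<rbrakk> \<Longrightarrow> x \<otimes> y \<in> carrier R"
    and mult_assoc: "\<lbrakk>x \<in> carrier R; y \<in> carrier R; z \<in> carrier R\<rbrakk>
      \<Longrightarrow> (x \<otimes> y) \<otimes> z = x \<otimes> (y \<otimes> z)"
    and distrib_right: "\<lbrakk>x \<in> carrier R; y \<in> carrier R; z \<in> carrier R\<rbrakk>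
      \<Longrightarrow> (x \<oplus> y) \<otimes> z = x \<otimes> z \<oplus> y \<otimes> z"
    and distrib_left: "\<lbrakk>x \<in> carrier R; y \<in> carrier R; z \<in> carrier R\<rbrakk>
      \<Longrightarrow> z \<otimes> (x \<oplus> y) = z \<otimes> x \<oplus> z \<otimes> y"

locale nonunital_ideal = additive_subgroup I R + nonunital_ring R
  for I and R (structure) +
  assumes mult_left: "\<lbrakk>a \<in> I; x \<in> carrier R\<rbrakk> \<Longrightarrow> x \<otimes> a \<in> I"
    and mult_right: "\<lbrakk>a \<in> I; x \<in> carrier R\<rbrakk> \<Longrightarrow> a \<otimes> x \<in> I"

text \<open>\<^const>\<open>ideal_prod\<close> is the set of finite sums of products, so it does not need a unit.\<close>

locale nonunital_prime_ring = nonunital_ring R for R (structure) +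
  assumes prime: "\<lbrakk>nonunital_ideal I R; nonunital_ideal J R; I \<noteq> {\<zero>}; J \<noteq> {\<zero>}\<rbrakk>
    \<Longrightarrow> I \<cdot> J \<noteq> {\<zero>}"


section \<open>Free algebras\<close>

text \<open>
  Words form the free monoid, written additively so that the convolution product of
  \<^theory>\<open>HOL-Library.Poly_Mapping\<close> turns \<open>'g word \<Rightarrow>\<^sub>0 'k\<close> into the free unital
  associative \<open>'k\<close>-algebra on the type \<open>'g\<close>.
\<close>

datatype 'a word = Word (letters: "'a list")

instantiation word :: (type) monoid_add
begin

definition zero_word :: "'a word" where "0 = Word []"

definition plus_word :: "'a word \<Rightarrow> 'a word \<Rightarrow> 'a word"
  where "u + v = Word (letters u @ letters v)"

instance
  by standard (simp_all add: zero_word_def plus_word_def)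

end

type_synonym ('g, 'k) free_alg = "'g word \<Rightarrow>\<^sub>0 'k"

definition gen :: "'g \<Rightarrow> ('g, 'k::field) free_alg"
  where "gen x = Poly_Mapping.single (Word [x]) 1"

text \<open>
  The free nonunital algebra on \<open>X\<close>: the combinations of nonempty words over \<open>X\<close>.
  The \<open>one\<close> field does not lie in the carrier.
\<close>

definition free_nonunital_algebra :: "'g set \<Rightarrow> ('g, 'k::field) free_alg ring"
  where "free_nonunital_algebra X =
    \<lparr>carrier = {f. \<forall>w \<in> Poly_Mapping.keys f. letters w \<noteq> [] \<and> set (letters w) \<subseteq> X},
     mult = (*), one = 1, zero = 0, add = (+)\<rparr>"

text \<open>
  The two-sided algebra ideal generated by \<open>S\<close>.  Multiplication by
  \<open>Poly_Mapping.single 0 c\<close> is multiplication by the scalar \<open>c\<close>.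
\<close>

inductive_set algebra_ideal_gen ::
    "'g set \<Rightarrow> ('g, 'k::field) free_alg set \<Rightarrow> ('g, 'k) free_alg set"
  for X :: "'g set" and S :: "('g, 'k) free_alg set" where
  incl: "f \<in> S \<Longrightarrow> f \<in> algebra_ideal_gen X S"
| zero: "0 \<in> algebra_ideal_gen X S"
| add: "\<lbrakk>f \<in> algebra_ideal_gen X S; g \<in> algebra_ideal_gen X S\<rbrakk>
    \<Longrightarrow> f + g \<in> algebra_ideal_gen X S"
| scale: "f \<in> algebra_ideal_gen X S
    \<Longrightarrow> Poly_Mapping.single 0 c * f \<in> algebra_ideal_gen X S"
| mult_left: "\<lbrakk>f \<in> algebra_ideal_gen X S; a \<in> carrier (free_nonunital_algebra X)\<rbrakk>
    \<Longrightarrow> a * f \<in> algebra_ideal_gen X S"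
| mult_right: "\<lbrakk>f \<in> algebra_ideal_gen X S; a \<in> carrier (free_nonunital_algebra X)\<rbrakk>
    \<Longrightarrow> f * a \<in> algebra_ideal_gen X S"


section \<open>Leavitt path algebras\<close>

text \<open>
  In a graph \<open>E\<close>, \<^const>\<open>tail\<close> is the source map and \<^const>\<open>head\<close> the range map.
\<close>

datatype ('v, 'e) lpa_gen = Vertex 'v | Edge 'e | Ghost 'e

definition lpa_gens :: "('v, 'e) pre_digraph \<Rightarrow> ('v, 'e) lpa_gen set"
  where "lpa_gens E = Vertex ` verts E \<union> Edge ` arcs E \<union> Ghost ` arcs E"

text \<open>A relation \<open>l = r\<close> is represented by \<open>l - r\<close>.\<close>

inductive_set lpa_relators ::
    "('v, 'e) pre_digraph \<Rightarrow> (('v, 'e) lpa_gen, 'k::field) free_alg set"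
  for E :: "('v, 'e) pre_digraph" where
  V: "\<lbrakk>v \<in> verts E; w \<in> verts E\<rbrakk> \<Longrightarrow>
    gen (Vertex v) * gen (Vertex w) - (if v = w then gen (Vertex v) else 0) \<in> lpa_relators E"
| E1_source: "e \<in> arcs E \<Longrightarrow>
    gen (Vertex (tail E e)) * gen (Edge e) - gen (Edge e) \<in> lpa_relators E"
| E1_range: "e \<in> arcs E \<Longrightarrow>
    gen (Edge e) * gen (Vertex (head E e)) - gen (Edge e) \<in> lpa_relators E"
| E2_range: "e \<in> arcs E \<Longrightarrow>
    gen (Vertex (head E e)) * gen (Ghost e) - gen (Ghost e) \<in> lpa_relators E"
| E2_source: "e \<in> arcs E \<Longrightarrow>
    gen (Ghost e) * gen (Vertex (tail E e)) - gen (Ghost e) \<in> lpa_relators E"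
| CK1: "\<lbrakk>e \<in> arcs E; e' \<in> arcs E\<rbrakk> \<Longrightarrow>
    gen (Ghost e) * gen (Edge e') - (if e = e' then gen (Vertex (head E e)) else 0)
      \<in> lpa_relators E"
| CK2: "\<lbrakk>v \<in> verts E; finite (out_arcs E v); out_arcs E v \<noteq> {}\<rbrakk> \<Longrightarrow>
    gen (Vertex v) - (\<Sum>e \<in> out_arcs E v. gen (Edge e) * gen (Ghost e)) \<in> lpa_relators E"

definition leavitt_path_algebra ::
    "'k::field itself \<Rightarrow> ('v, 'e) pre_digraph \<Rightarrow> (('v, 'e) lpa_gen, 'k) free_alg set ring"
  where "leavitt_path_algebra K E =
    free_nonunital_algebra (lpa_gens E) Quot algebra_ideal_gen (lpa_gens E) (lpa_relators E)"


section \<open>The Leavitt path algebra is a nonunital ring\<close>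

context nonunital_ideal
begin

lemma abelian_subgroup: "abelian_subgroup I R"
  by (rule abelian_subgroupI3) unfold_locales

lemma rcoset_mult:
  assumes x: "x \<in> carrier R" and y: "y \<in> carrier R"
  shows "[mod I:] (I +> x) \<Otimes> (I +> y) = I +> (x \<otimes> y)"
proof -
  interpret abelian_subgroup I R by (rule abelian_subgroup)
  have 1: "I +> (h \<oplus> x) \<otimes> (k \<oplus> y) = I +> x \<otimes> y" if hk: "h \<in> I" "k \<in> I" for h k
  proof -
    have c: "h \<in> carrier R" "k \<in> carrier R"
      using hk a_Hcarr by auto
    have "(h \<oplus> x) \<otimes> (k \<oplus> y) = (h \<otimes> (k \<oplus> y) \<oplus> x \<otimes> k) \<oplus> x \<otimes> y"
    proof -
      have "(h \<oplus> x) \<otimes> (k \<oplus> y) = h \<otimes> (k \<oplus> y) \<oplus> (x \<otimes> k \<oplus> x \<otimes> y)"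
        using c x y distrib_right[of h x "k \<oplus> y"] distrib_left[of k y x] by simp
      also have "\<dots> = (h \<otimes> (k \<oplus> y) \<oplus> x \<otimes> k) \<oplus> x \<otimes> y"
        using c x y by (intro a_assoc[symmetric]) (auto intro: mult_closed)
      finally show ?thesis .
    qed
    moreover have "h \<otimes> (k \<oplus> y) \<oplus> x \<otimes> k \<in> I"
      using hk c x y by (simp add: mult_left mult_right)
    ultimately have "(h \<oplus> x) \<otimes> (k \<oplus> y) \<in> I +> x \<otimes> y"
      by (auto simp: a_r_coset_def')
    then show ?thesis
      using a_repr_independence'[of _ "x \<otimes> y"] x y mult_closed by simp
  qed
  have 2: "I +> a \<otimes> b = I +> x \<otimes> y" if ab: "a \<in> I +> x" "b \<in> I +> y" for a b
  proof -
    obtain h k where "h \<in> I" "k \<in> I" "a = h \<oplus> x" "b = k \<oplus> y"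
      using ab by (auto simp: a_r_coset_def')
    then show ?thesis by (simp add: 1)
  qed
  have "x \<in> I +> x" "y \<in> I +> y" using a_rcos_self x y by auto
  then show ?thesis
    unfolding rcoset_mult_def using 2 by blast
qed

lemma nonunital_ring_Quot: "nonunital_ring (R Quot I)"
proof -
  interpret abelian_subgroup I R by (rule abelian_subgroup)
  have "abelian_group (R Quot I)"
    by (rule comm_group_abelian_groupI)
      (simp add: FactRing_def a_factorgroup_is_comm_group[unfolded A_FactGroup_def'])
  then show ?thesis
    by (intro nonunital_ring.intro nonunital_ring_axioms.intro)
      (auto simp: FactRing_simps rcoset_mult a_rcos_sum mult_closed mult_assoc
        distrib_left distrib_right)
qed

end

lemma nonunital_ring_free: "nonunital_ring (free_nonunital_algebra X :: ('g, 'k::field) free_alg ring)"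
  (is "nonunital_ring ?F")
proof -
  have ops: "x \<otimes>\<^bsub>?F\<^esub> y = x * y" "x \<oplus>\<^bsub>?F\<^esub> y = x + y" "\<zero>\<^bsub>?F\<^esub> = 0"
    for x y :: "('g, 'k) free_alg"
    by (simp_all add: free_nonunital_algebra_def)
  have plus: "f + g \<in> carrier ?F" if "f \<in> carrier ?F" "g \<in> carrier ?F" for f g
    using that Poly_Mapping.keys_add[of f g] by (auto simp: free_nonunital_algebra_def)
  have times: "f * g \<in> carrier ?F" if "f \<in> carrier ?F" "g \<in> carrier ?F" for f g
    using that keys_mult[of f g] by (fastforce simp: free_nonunital_algebra_def plus_word_def)
  have zero: "0 \<in> carrier ?F"
    by (simp add: free_nonunital_algebra_def)
  have inverse: "\<exists>y\<in>carrier ?F. x + y = 0" if "x \<in> carrier ?F" for x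
    using that by (intro bexI[of _ "-x"]) (simp_all add: free_nonunital_algebra_def)
  have "abelian_group ?F"
    by (rule abelian_groupI) (simp_all add: ops plus zero inverse add.assoc add.commute)
  then show ?thesis
    by (intro nonunital_ring.intro nonunital_ring_axioms.intro)
      (simp_all add: ops times mult.assoc distrib_left distrib_right)
qed

lemma nonunital_ideal_algebra_ideal_gen:
  fixes S :: "('g, 'k::field) free_alg set"
  assumes S: "S \<subseteq> carrier (free_nonunital_algebra X)"
  shows "nonunital_ideal (algebra_ideal_gen X S) (free_nonunital_algebra X)"
    (is "nonunital_ideal ?J ?F")
proof -
  interpret nonunital_ring ?F by (rule nonunital_ring_free)
  have ops: "x \<otimes>\<^bsub>?F\<^esub> y = x * y" "x \<oplus>\<^bsub>?F\<^esub> y = x + y" "\<zero>\<^bsub>?F\<^esub> = 0" for x y :: "('g, 'k) free_alg"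
    by (simp_all add: free_nonunital_algebra_def)
  have sub: "f \<in> carrier ?F" if "f \<in> ?J" for f
    using that
  proof induction
    case (scale f c)
    then show ?case
      using keys_mult[of "Poly_Mapping.single 0 c" f]
      by (fastforce simp: free_nonunital_algebra_def plus_word_def zero_word_def split: if_splits)
  qed (use S a_closed mult_closed zero_closed in \<open>auto simp: ops\<close>)
  have neg: "-f \<in> ?J" if "f \<in> ?J" for f
    using algebra_ideal_gen.scale[OF that, of "-1"]
    by (simp add: single_uminus)
  have "additive_subgroup ?J ?F"
  proof (rule additive_subgroup.intro, rule add.subgroupI)
    show "\<ominus>\<^bsub>?F\<^esub> a \<in> ?J" if "a \<in> ?J" for a
    proof -
      have "\<ominus>\<^bsub>?F\<^esub> a = - a"
        using minus_equality[of "-a" a] sub[OF that] sub[OF neg[OF that]] by (simp add: ops)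
      then show ?thesis using neg[OF that] by simp
    qed
  qed (use sub algebra_ideal_gen.zero in \<open>auto simp: ops intro: algebra_ideal_gen.intros\<close>)
  then show ?thesis
    by (intro nonunital_ideal.intro nonunital_ideal_axioms.intro)
      (auto simp: ops nonunital_ring_free intro: algebra_ideal_gen.intros)
qed

lemma gen_closed: "x \<in> X \<Longrightarrow> gen x \<in> carrier (free_nonunital_algebra X)"
  by (auto simp: gen_def free_nonunital_algebra_def)

lemma lpa_relators_subset:
  assumes "wf_digraph E"
  shows "(lpa_relators E :: (('v, 'e) lpa_gen, 'k::field) free_alg set)
    \<subseteq> carrier (free_nonunital_algebra (lpa_gens E))"
    (is "_ \<subseteq> carrier ?F")
proof
  interpret wf_digraph E by fact
  interpret nonunital_ring ?F by (rule nonunital_ring_free)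
  have times: "x * y \<in> carrier ?F" if "x \<in> carrier ?F" "y \<in> carrier ?F" for x y
    using mult_closed[OF that] by (simp add: free_nonunital_algebra_def)
  have plus: "x + y \<in> carrier ?F" if "x \<in> carrier ?F" "y \<in> carrier ?F" for x y
    using a_closed[OF that] by (simp add: free_nonunital_algebra_def)
  have minus: "x - y \<in> carrier ?F" if "x \<in> carrier ?F" "y \<in> carrier ?F" for x y
  proof -
    have "- y \<in> carrier ?F"
      using that by (simp add: free_nonunital_algebra_def)
    from plus[OF that(1) this] show ?thesis by simp
  qed
  have zero: "0 \<in> carrier ?F" by (simp add: free_nonunital_algebra_def)
  have sum: "sum h A \<in> carrier ?F" if "\<And>a. a \<in> A \<Longrightarrow> h a \<in> carrier ?F" for h and A :: "'e set"
    using that by (induction A rule: infinite_finite_induct) (auto simp: zero plus)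
  have vertex: "gen (Vertex v) \<in> carrier ?F" if "v \<in> verts E" for v
    using that by (intro gen_closed) (simp add: lpa_gens_def)
  have edge: "gen (Edge e) \<in> carrier ?F" and ghost: "gen (Ghost e) \<in> carrier ?F"
    if "e \<in> arcs E" for e
    using that by (auto intro!: gen_closed simp: lpa_gens_def)
  show "f \<in> carrier ?F" if "f \<in> lpa_relators E" for f :: "(('v, 'e) lpa_gen, 'k) free_alg"
    using that
    by cases (auto intro!: minus times zero sum vertex edge ghost)
qed

lemma nonunital_ring_leavitt_path_algebra:
  assumes "wf_digraph E"
  shows "nonunital_ring (leavitt_path_algebra TYPE('k::field) E)"
  unfolding leavitt_path_algebra_def
  by (intro nonunital_ideal.nonunital_ring_Quot nonunital_ideal_algebra_ideal_gen
      lpa_relators_subset assms)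


section \<open>Condition (MT3)\<close>

definition connects_to :: "('v, 'e) pre_digraph \<Rightarrow> 'v \<Rightarrow> 'v \<Rightarrow> bool"
  where "connects_to E u v \<longleftrightarrow> (\<exists>p. pre_digraph.awalk E u p v)"

definition MT3 :: "('v, 'e) pre_digraph \<Rightarrow> bool"
  where "MT3 E \<longleftrightarrow>
    (\<forall>v \<in> verts E. \<forall>w \<in> verts E. \<exists>u \<in> verts E. connects_to E v u \<and> connects_to E w u)"

end

theory Submission
  imports Defs
begin

text \<open>
  All computations take place in the free algebra, modulo the ideal \<open>null\<close> generated by the
  relations; \<open>f \<approx> g\<close> means that \<open>f\<close> and \<open>g\<close> agree in the Leavitt path algebra \<open>L\<close>.

  Every nonempty word in the generators is zero in \<open>L\<close> or equal to some \<open>\<alpha>\<beta>\<^sup>*\<close> with paths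
  \<open>\<alpha>\<close>, \<open>\<beta>\<close> that end at the same vertex (\<open>normalizable\<close>).  Hence if \<open>v\<close> and \<open>w\<close> do not connect
  to a common vertex, then \<open>v L w = 0\<close> (\<open>not_connected_imp_null\<close>), whereas \<open>v\<close> and \<open>w\<close> are
  nonzero (\<open>vertex_not_null\<close>).  So \<open>L\<close> is not prime if (MT3) fails.

  Conversely, assume (MT3) and let \<open>f\<close>, \<open>g\<close> be nonzero with \<open>f L g = 0\<close>.  The relations are
  homogeneous if edges have degree \<open>1\<close>, ghost edges degree \<open>-1\<close> and vertices degree \<open>0\<close>
  (\<open>component_null\<close>), so \<open>L\<close> is graded by the integers and \<open>f\<close> and \<open>g\<close> may be replaced by their
  nonzero components of highest degree (\<open>top_components_mult\<close>).  A nonzero homogeneous element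
  can be multiplied from both sides to a nonzero multiple of a vertex
  (\<open>homogeneous_reduction\<close>): right multiplication by edges and vertices removes all ghost edges,
  and by (CK2) this can be done without reaching zero (\<open>remove_ghosts\<close>); then multiplication by \<open>\<alpha>\<^sup>*\<close> from the left isolates the coefficient
  of a path \<open>\<alpha>\<close>, as all paths that occur have the same length.  Thus \<open>v L v' = 0\<close> for some
  vertices \<open>v\<close>, \<open>v'\<close>.  But (MT3) gives paths \<open>p\<close> and \<open>q\<close> from \<open>v\<close> and \<open>v'\<close> to a common vertex
  \<open>r\<close>, and \<open>p q\<^sup>*\<close> is a nonzero element of \<open>v L v'\<close> because \<open>p\<^sup>* p q\<^sup>* q = r\<close>.

  That vertices are nonzero is shown with a representation.  The generators act on the finite
  paths by adding and removing a first edge.  Relation (CK2) fails in this representation, but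
  only on trivial paths, so each element of \<open>null\<close> still kills all paths that are sufficiently
  long or end at a vertex to which (CK2) does not apply (\<open>null_kills_long_paths\<close>).  From every
  vertex \<open>v\<close> there is such a path, and \<open>v\<close> fixes it.
\<close>


section \<open>Monomials and degree components of the free algebra\<close>

lemma sum_monomials:
  fixes f :: "'a \<Rightarrow>\<^sub>0 'b::comm_monoid_add"
  shows "f = (\<Sum>w\<in>Poly_Mapping.keys f. Poly_Mapping.single w (Poly_Mapping.lookup f w))"
proof (rule poly_mapping_eqI)
  fix k
  have "(\<Sum>w\<in>Poly_Mapping.keys f. (Poly_Mapping.lookup f w when w = k)) = Poly_Mapping.lookup f k"
    by (cases "k \<in> Poly_Mapping.keys f") (auto simp: when_def in_keys_iff)
  then show "Poly_Mapping.lookup f k = Poly_Mapping.lookup (\<Sum>w\<in>Poly_Mapping.keys f. Poly_Mapping.single w (Poly_Mapping.lookup f w)) k"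
    by (simp add: lookup_sum lookup_single)
qed

lemma monomial_induct [case_names single zero add]:
  fixes f :: "'a \<Rightarrow>\<^sub>0 'b::comm_monoid_add"
  assumes "\<And>w c. w \<in> Poly_Mapping.keys f \<Longrightarrow> P (Poly_Mapping.single w c)"
    and "P 0" and "\<And>a b. P a \<Longrightarrow> P b \<Longrightarrow> P (a + b)"
  shows "P f"
proof -
  have "P (\<Sum>w\<in>A. Poly_Mapping.single w (Poly_Mapping.lookup f w))"
    if "A \<subseteq> Poly_Mapping.keys f" for A
    using finite_subset[OF that finite_keys] that
    by (induction A rule: finite_induct) (auto intro: assms)
  then show ?thesis by (subst sum_monomials) simp
qed

text \<open>The monomial of a word, given as a list of generators.\<close>

definition mon :: "'g list \<Rightarrow> ('g, 'k::field) free_alg"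
  where "mon w = Poly_Mapping.single (Word w) 1"

text \<open>Scalars as elements of the free algebra; the word \<open>0\<close> is the empty word.\<close>

abbreviation scal :: "'k \<Rightarrow> ('g, 'k::field) free_alg"
  where "scal c \<equiv> Poly_Mapping.single 0 c"

lemma mon_mult [simp]: "mon u * mon w = mon (u @ w)"
  by (simp add: mon_def mult_single plus_word_def)

lemma mon_Nil [simp]: "mon [] = 1"
  by (metis mon_def single_one zero_word_def)

lemma gen_eq_mon: "gen x = mon [x]"
  by (simp add: gen_def mon_def)

lemma scal_mon: "scal c * mon w = Poly_Mapping.single (Word w) c"
  by (simp add: mon_def mult_single)

lemma scal_commute: "f * scal c = scal c * (f :: ('g, 'k::field) free_alg)"
  by (induction f rule: monomial_induct) (simp_all add: mult_single algebra_simps)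

lemma mult_scal_left: "f * (scal c * g) = scal c * (f * (g :: ('g, 'k::field) free_alg))"
  by (metis mult.assoc scal_commute)

lemma scal_inverse: "c \<noteq> 0 \<Longrightarrow> scal (inverse c) * (scal c * f) = (f :: ('g, 'k::field) free_alg)"
  by (simp add: mult.assoc[symmetric] mult_single)

text \<open>The part of degree \<open>n\<close>, for a degree function \<open>d\<close> on words.\<close>

definition component :: "('g word \<Rightarrow> int) \<Rightarrow> int \<Rightarrow> ('g, 'k::field) free_alg \<Rightarrow> ('g, 'k) free_alg"
  where "component d n f = Poly_Mapping.mapp (\<lambda>w c. c when d w = n) f"

lemma lookup_component: "Poly_Mapping.lookup (component d n f) w = (Poly_Mapping.lookup f w when d w = n)"
  by (auto simp: component_def lookup_mapp when_def in_keys_iff)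

lemma component_zero [simp]: "component d n 0 = 0"
  by (rule poly_mapping_eqI) (simp add: lookup_component)

lemma component_add: "component d n (f + g) = component d n f + component d n g"
  by (rule poly_mapping_eqI) (simp add: lookup_component lookup_add when_add_distrib)

lemma component_sum: "component d n (sum h A) = (\<Sum>a\<in>A. component d n (h a))"
  by (induction A rule: infinite_finite_induct) (simp_all add: component_add)

lemma component_single:
  "component d n (Poly_Mapping.single w c) = (if d w = n then Poly_Mapping.single w c else 0)"
  by (rule poly_mapping_eqI) (auto simp: lookup_component lookup_single when_def)

lemma keys_component: "Poly_Mapping.keys (component d n f) = {w \<in> Poly_Mapping.keys f. d w = n}"
  by (auto simp: in_keys_iff lookup_component)

lemma component_homogeneous:
  assumes "\<And>w. w \<in> Poly_Mapping.keys f \<Longrightarrow> d w = m"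
  shows "component d n f = (if n = m then f else 0)"
  using assms by (intro poly_mapping_eqI) (auto simp: lookup_component when_def in_keys_iff)

lemma sum_components: "f = (\<Sum>n\<in>d ` Poly_Mapping.keys f. component d n f)"
proof (rule poly_mapping_eqI)
  fix w
  have "(\<Sum>n\<in>d ` Poly_Mapping.keys f. (Poly_Mapping.lookup f w when d w = n)) = Poly_Mapping.lookup f w"
    by (cases "w \<in> Poly_Mapping.keys f") (auto simp: when_def in_keys_iff)
  then show "Poly_Mapping.lookup f w = Poly_Mapping.lookup (\<Sum>n\<in>d ` Poly_Mapping.keys f. component d n f) w"
    by (simp add: lookup_sum lookup_component)
qed

lemma component_single_mult:
  assumes "\<And>u v. d (u + v) = d u + d v"
  shows "component d n (Poly_Mapping.single w c * f) = Poly_Mapping.single w c * component d (n - d w) f"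
  by (induction f rule: monomial_induct)
    (auto simp: component_add distrib_left mult_single component_single assms)

lemma component_mult_single:
  assumes "\<And>u v. d (u + v) = d u + d v"
  shows "component d n (f * Poly_Mapping.single w c) = component d (n - d w) f * Poly_Mapping.single w c"
  by (induction f rule: monomial_induct)
    (auto simp: component_add distrib_right mult_single component_single assms)

text \<open>
  To show that a property holds throughout a generated ideal, it is enough to multiply by monomials.
\<close>

lemma algebra_ideal_gen_monomial_induct [consumes 1, case_names incl zero add left right]:
  fixes f :: "('g, 'k::field) free_alg"
  assumes "f \<in> algebra_ideal_gen X S"
    and incl: "\<And>f. f \<in> S \<Longrightarrow> P f" and zero: "P 0"
    and add: "\<And>f g. P f \<Longrightarrow> P g \<Longrightarrow> P (f + g)"
    and left: "\<And>f w c. P f \<Longrightarrow> set w \<subseteq> X \<Longrightarrow> P (Poly_Mapping.single (Word w) c * f)"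
    and right: "\<And>f w c. P f \<Longrightarrow> set w \<subseteq> X \<Longrightarrow> P (f * Poly_Mapping.single (Word w) c)"
  shows "P f"
  using assms(1)
proof induction
  case (scale f c)
  then show ?case using left[of f "[]" c] by (simp add: zero_word_def)
next
  case (mult_left f a)
  from \<open>a \<in> _\<close> have "P (Poly_Mapping.single w c * f)" if "w \<in> Poly_Mapping.keys a" for w c
    using that left[OF mult_left(3), of "letters w" c] by (auto simp: free_nonunital_algebra_def)
  then show ?case
    by (intro monomial_induct[of a "\<lambda>a. P (a * f)"]) (auto simp: zero add distrib_right)
next
  case (mult_right f a)
  from \<open>a \<in> _\<close> have "P (f * Poly_Mapping.single w c)" if "w \<in> Poly_Mapping.keys a" for w c
    using that right[OF mult_right(3), of "letters w" c] by (auto simp: free_nonunital_algebra_def)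
  then show ?case
    by (intro monomial_induct[of a "\<lambda>a. P (f * a)"]) (auto simp: zero add distrib_left)
qed (auto intro: incl zero add)


section \<open>Primeness in terms of elements\<close>

lemma (in nonunital_ring) prime_ring_if_elementwise:
  assumes *: "\<And>x y. \<lbrakk>x \<in> carrier R; y \<in> carrier R; \<And>r. r \<in> carrier R \<Longrightarrow> (x \<otimes> r) \<otimes> y = \<zero>\<rbrakk>
    \<Longrightarrow> x = \<zero> \<or> y = \<zero>"
  shows "nonunital_prime_ring R"
proof
  fix I J assume I: "nonunital_ideal I R" and J: "nonunital_ideal J R"
    and ne: "I \<noteq> {\<zero>}" "J \<noteq> {\<zero>}"
  interpret I: nonunital_ideal I R by fact
  interpret J: nonunital_ideal J R by fact
  obtain x where x: "x \<in> I" "x \<noteq> \<zero>" using ne(1) I.zero_closed by blast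
  obtain y where y: "y \<in> J" "y \<noteq> \<zero>" using ne(2) J.zero_closed by blast
  have c: "x \<in> carrier R" "y \<in> carrier R" using x y I.a_subset J.a_subset by auto
  then obtain r where r: "r \<in> carrier R" "(x \<otimes> r) \<otimes> y \<noteq> \<zero>" using * x y by blast
  have "(x \<otimes> r) \<otimes> y \<in> I \<cdot> J"
    using I.mult_right[OF x(1) r(1)] y(1) by (rule ideal_prod.prod)
  with r(2) show "I \<cdot> J \<noteq> {\<zero>}" by blast
qed

text \<open>
  The converse holds without a unit if \<open>y\<close> has a left unit \<open>z\<close>: the ideals that give a
  contradiction are \<open>{a. a R y = 0}\<close> and its right annihilator, which contains
  \<open>y = z y\<close>.
\<close>

lemma (in nonunital_prime_ring) prime_elementwise:
  assumes x: "x \<in> carrier R" and y: "y \<in> carrier R" and z: "z \<in> carrier R" "z \<otimes> y = y"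
    and 0: "\<And>r. r \<in> carrier R \<Longrightarrow> (x \<otimes> r) \<otimes> y = \<zero>"
  shows "x = \<zero> \<or> y = \<zero>"
proof (rule ccontr)
  assume ne: "\<not> (x = \<zero> \<or> y = \<zero>)"
  have zl: "\<zero> \<otimes> a = \<zero>" if "a \<in> carrier R" for a
    using distrib_right[of \<zero> \<zero> a] that mult_closed[of \<zero> a]
    by (metis add.r_cancel_one' r_zero zero_closed)
  have zr: "a \<otimes> \<zero> = \<zero>" if "a \<in> carrier R" for a
    using distrib_left[of \<zero> \<zero> a] that mult_closed[of a \<zero>]
    by (metis add.r_cancel_one' r_zero zero_closed)
  have ml: "(\<ominus> a) \<otimes> b = \<ominus> (a \<otimes> b)" if "a \<in> carrier R" "b \<in> carrier R" for a b
    using distrib_right[of "\<ominus> a" a b] that mult_closed zl[of b] l_neg[of a]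
    by (metis a_inv_closed minus_equality)
  have mr: "b \<otimes> (\<ominus> a) = \<ominus> (b \<otimes> a)" if "a \<in> carrier R" "b \<in> carrier R" for a b
    using distrib_left[of "\<ominus> a" a b] that mult_closed zr[of b] l_neg[of a]
    by (metis a_inv_closed minus_equality)
  define I where "I = {a \<in> carrier R. \<forall>r\<in>carrier R. (a \<otimes> r) \<otimes> y = \<zero>}"
  define J where "J = {b \<in> carrier R. \<forall>a\<in>I. a \<otimes> b = \<zero>}"
  have Ic: "I \<subseteq> carrier R" by (auto simp: I_def)
  have asg: "additive_subgroup A R" if "A \<subseteq> carrier R" "\<zero> \<in> A"
    "\<And>a b. a \<in> A \<Longrightarrow> b \<in> A \<Longrightarrow> a \<oplus> b \<in> A" "\<And>a. a \<in> A \<Longrightarrow> \<ominus> a \<in> A" for A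
    using that by (intro additive_subgroup.intro add.subgroupI) (auto)
  have I: "nonunital_ideal I R"
  proof (intro nonunital_ideal.intro nonunital_ideal_axioms.intro asg nonunital_ring_axioms)
    fix a r assume a: "a \<in> I" and r: "r \<in> carrier R"
    have "(a \<otimes> r) \<otimes> t \<otimes> y = \<zero>" if "t \<in> carrier R" for t
      using a r that mult_closed[OF r that] by (simp add: I_def mult_assoc[of a r t])
    then show "a \<otimes> r \<in> I"
      using a r mult_closed by (simp add: I_def)
    show "r \<otimes> a \<in> I"
      using a r mult_closed y zr by (auto simp: I_def mult_assoc)
  qed (use y in \<open>auto simp: I_def zl distrib_right mult_closed ml\<close>)
  have J: "nonunital_ideal J R"
  proof (intro nonunital_ideal.intro nonunital_ideal_axioms.intro asg nonunital_ring_axioms)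
    fix b r assume b: "b \<in> J" and r: "r \<in> carrier R"
    have Jc: "b \<in> carrier R" using b by (simp add: J_def)
    show "b \<otimes> r \<in> J"
      using Ic b r mult_closed zl by (auto simp: J_def mult_assoc[symmetric] subset_iff)
    have "a \<otimes> (r \<otimes> b) = \<zero>" if "a \<in> I" for a
      using b nonunital_ideal.mult_right[OF I that r] Ic that r Jc
      by (auto simp: J_def mult_assoc[symmetric] subset_iff)
    then show "r \<otimes> b \<in> J" using mult_closed r Jc by (auto simp: J_def)
  qed (use Ic in \<open>auto simp: J_def zr distrib_left mult_closed mr subset_iff\<close>)
  have "x \<in> I" using x 0 by (simp add: I_def)
  then have "I \<noteq> {\<zero>}" using ne by blast
  moreover have "y \<in> J"
    using y z by (auto simp: J_def I_def mult_assoc)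
  then have "J \<noteq> {\<zero>}" using ne by blast
  ultimately have "I \<cdot> J \<noteq> {\<zero>}" using prime I J by blast
  moreover have "t = \<zero>" if "t \<in> I \<cdot> J" for t
    using that by induction (auto simp: J_def)
  moreover have "\<zero> \<in> I \<cdot> J"
    using ideal_prod.prod[of x I y J R] \<open>x \<in> I\<close> \<open>y \<in> J\<close> by (auto simp: J_def)
  ultimately show False by blast
qed


section \<open>The ideal of relations\<close>

text \<open>
  The parameter \<open>K\<close> only serves to fix the type of the coefficient field in the locale.
\<close>

locale leavitt = wf_digraph G for G :: "('v, 'e) pre_digraph" +
  fixes K :: "'k::field itself"
begin

text \<open>The elements of the free algebra that vanish in the Leavitt path algebra.\<close>

definition null :: "(('v, 'e) lpa_gen, 'k) free_alg set"
  where "null = algebra_ideal_gen (lpa_gens G) (lpa_relators G)"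

abbreviation free_ring :: "(('v, 'e) lpa_gen, 'k) free_alg ring"
  where "free_ring \<equiv> free_nonunital_algebra (lpa_gens G)"

lemma null_ideal: "nonunital_ideal null free_ring"
  unfolding null_def by (intro nonunital_ideal_algebra_ideal_gen lpa_relators_subset wf_digraph_axioms)

lemma null_carrier: "f \<in> null \<Longrightarrow> f \<in> carrier free_ring"
  using nonunital_ideal.axioms(1)[OF null_ideal] additive_subgroup.a_subset by blast

lemma null_zero [simp]: "0 \<in> null"
  by (simp add: null_def algebra_ideal_gen.zero)

lemma null_add: "f \<in> null \<Longrightarrow> g \<in> null \<Longrightarrow> f + g \<in> null"
  by (simp add: null_def algebra_ideal_gen.add)

lemma null_scal: "f \<in> null \<Longrightarrow> scal c * f \<in> null"
  by (simp add: null_def algebra_ideal_gen.scale)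

lemma null_uminus: "f \<in> null \<Longrightarrow> - f \<in> null"
  using null_scal[of f "-1"] by (simp add: single_uminus)

lemma null_diff: "f \<in> null \<Longrightarrow> g \<in> null \<Longrightarrow> f - g \<in> null"
  using null_add[of f "-g"] null_uminus[of g] by simp

lemma null_sum: "(\<And>a. a \<in> A \<Longrightarrow> h a \<in> null) \<Longrightarrow> sum h A \<in> null"
  by (induction A rule: infinite_finite_induct) (auto intro: null_add)

lemma null_scal_iff: "c \<noteq> 0 \<Longrightarrow> scal c * f \<in> null \<longleftrightarrow> f \<in> null"
  using null_scal[of "scal c * f" "inverse c"] null_scal[of f c] by (auto simp: scal_inverse)

lemma mon_carrier: "w \<noteq> [] \<Longrightarrow> set w \<subseteq> lpa_gens G \<Longrightarrow> mon w \<in> carrier free_ring"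
  by (simp add: mon_def free_nonunital_algebra_def)

lemma carrier_mult_null: "f \<in> carrier free_ring \<Longrightarrow> g \<in> null \<Longrightarrow> f * g \<in> null"
  by (simp add: null_def algebra_ideal_gen.mult_left)

lemma null_mult_carrier: "f \<in> null \<Longrightarrow> g \<in> carrier free_ring \<Longrightarrow> f * g \<in> null"
  by (simp add: null_def algebra_ideal_gen.mult_right)

lemma mon_mult_null: "f \<in> null \<Longrightarrow> set w \<subseteq> lpa_gens G \<Longrightarrow> mon w * f \<in> null"
  by (cases "w = []") (auto intro: carrier_mult_null mon_carrier)

lemma null_mult_mon: "f \<in> null \<Longrightarrow> set w \<subseteq> lpa_gens G \<Longrightarrow> f * mon w \<in> null"
  by (cases "w = []") (auto intro: null_mult_carrier mon_carrier)

lemma lpa_gens_simps [simp]: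
  "Vertex v \<in> lpa_gens G \<longleftrightarrow> v \<in> verts G"
  "Edge e \<in> lpa_gens G \<longleftrightarrow> e \<in> arcs G"
  "Ghost e \<in> lpa_gens G \<longleftrightarrow> e \<in> arcs G"
  by (auto simp: lpa_gens_def)

text \<open>Equality in the Leavitt path algebra.\<close>

definition eqv :: "(('v, 'e) lpa_gen, 'k) free_alg \<Rightarrow> (('v, 'e) lpa_gen, 'k) free_alg \<Rightarrow> bool"
    (infix "\<approx>" 50)
  where "f \<approx> g \<longleftrightarrow> f - g \<in> null"

lemma eqv_refl [simp]: "f \<approx> f"
  by (simp add: eqv_def)

lemma eqv_sym: "f \<approx> g \<Longrightarrow> g \<approx> f"
  using null_uminus by (fastforce simp: eqv_def)

lemma eqv_trans [trans]: "f \<approx> g \<Longrightarrow> g \<approx> h \<Longrightarrow> f \<approx> h"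
  using null_add by (fastforce simp: eqv_def)

lemma eqv_zero [simp]: "f \<approx> 0 \<longleftrightarrow> f \<in> null"
  by (simp add: eqv_def)

lemma eqv_null: "f \<approx> g \<Longrightarrow> f \<in> null \<longleftrightarrow> g \<in> null"
  by (metis eqv_sym eqv_trans eqv_zero)

lemma eqv_add: "f \<approx> g \<Longrightarrow> f' \<approx> g' \<Longrightarrow> f + f' \<approx> g + g'"
  using null_add[of "f - g" "f' - g'"] by (simp add: eqv_def algebra_simps)

lemma eqv_diff: "f \<approx> g \<Longrightarrow> f' \<approx> g' \<Longrightarrow> f - f' \<approx> g - g'"
  using null_diff[of "f - g" "f' - g'"] by (simp add: eqv_def algebra_simps)

lemma eqv_sum: "(\<And>a. a \<in> A \<Longrightarrow> h a \<approx> k a) \<Longrightarrow> sum h A \<approx> sum k A"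
  by (induction A rule: infinite_finite_induct) (auto intro: eqv_add)

lemma eqv_scal: "f \<approx> g \<Longrightarrow> scal c * f \<approx> scal c * g"
  using null_scal[of "f - g" c] by (simp add: eqv_def algebra_simps)

lemma eqv_mon_left: "f \<approx> g \<Longrightarrow> set w \<subseteq> lpa_gens G \<Longrightarrow> mon w * f \<approx> mon w * g"
  using mon_mult_null[of "f - g" w] by (simp add: eqv_def algebra_simps)

lemma eqv_mon_right: "f \<approx> g \<Longrightarrow> set w \<subseteq> lpa_gens G \<Longrightarrow> f * mon w \<approx> g * mon w"
  using null_mult_mon[of "f - g" w] by (simp add: eqv_def algebra_simps)

lemma eqv_carrier_left: "f \<approx> g \<Longrightarrow> h \<in> carrier free_ring \<Longrightarrow> h * f \<approx> h * g"
  using carrier_mult_null[of h "f - g"] by (simp add: eqv_def algebra_simps)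

lemma eqv_context:
  "mon u \<approx> mon w \<Longrightarrow> set a \<subseteq> lpa_gens G \<Longrightarrow> set b \<subseteq> lpa_gens G
    \<Longrightarrow> mon (a @ u @ b) \<approx> mon (a @ w @ b)"
  using eqv_mon_left[OF eqv_mon_right[of "mon u" "mon w" b], of a] by simp

lemma null_context:
  "mon u \<in> null \<Longrightarrow> set a \<subseteq> lpa_gens G \<Longrightarrow> set b \<subseteq> lpa_gens G
    \<Longrightarrow> mon (a @ u @ b) \<in> null"
  using mon_mult_null[OF null_mult_mon[of "mon u" b], of a] by simp

lemmas eqv_Cons = eqv_context[of _ _ "[_]" "[]", simplified]
lemmas eqv_append = eqv_context[of _ _ "[]", simplified]
lemmas null_Cons = null_context[of _ "[_]" "[]", simplified]
lemmas null_append = null_context[of _ "[]", simplified]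

lemma relators_null: "f \<in> lpa_relators G \<Longrightarrow> f \<in> null"
  by (simp add: null_def algebra_ideal_gen.incl)

lemma vertex_vertex: "v \<in> verts G \<Longrightarrow> mon [Vertex v, Vertex v] \<approx> mon [Vertex v]"
  using relators_null[OF lpa_relators.V[of v G v]] by (simp add: eqv_def gen_eq_mon)

lemma vertex_vertex_null:
  "v \<in> verts G \<Longrightarrow> w \<in> verts G \<Longrightarrow> v \<noteq> w \<Longrightarrow> mon [Vertex v, Vertex w] \<in> null"
  using relators_null[OF lpa_relators.V[of v G w]] by (simp add: gen_eq_mon)

lemma tail_edge: "e \<in> arcs G \<Longrightarrow> mon [Vertex (tail G e), Edge e] \<approx> mon [Edge e]"
  using relators_null[OF lpa_relators.E1_source[of e G]] by (simp add: eqv_def gen_eq_mon)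

lemma edge_head: "e \<in> arcs G \<Longrightarrow> mon [Edge e, Vertex (head G e)] \<approx> mon [Edge e]"
  using relators_null[OF lpa_relators.E1_range[of e G]] by (simp add: eqv_def gen_eq_mon)

lemma head_ghost: "e \<in> arcs G \<Longrightarrow> mon [Vertex (head G e), Ghost e] \<approx> mon [Ghost e]"
  using relators_null[OF lpa_relators.E2_range[of e G]] by (simp add: eqv_def gen_eq_mon)

lemma ghost_tail: "e \<in> arcs G \<Longrightarrow> mon [Ghost e, Vertex (tail G e)] \<approx> mon [Ghost e]"
  using relators_null[OF lpa_relators.E2_source[of e G]] by (simp add: eqv_def gen_eq_mon)

lemma ghost_edge: "e \<in> arcs G \<Longrightarrow> mon [Ghost e, Edge e] \<approx> mon [Vertex (head G e)]"
  using relators_null[OF lpa_relators.CK1[of e G e]] by (simp add: eqv_def gen_eq_mon)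

lemma ghost_edge_null: "e \<in> arcs G \<Longrightarrow> f \<in> arcs G \<Longrightarrow> e \<noteq> f \<Longrightarrow> mon [Ghost e, Edge f] \<in> null"
  using relators_null[OF lpa_relators.CK1[of e G f]] by (simp add: gen_eq_mon)

lemma vertex_sum_edges:
  "v \<in> verts G \<Longrightarrow> finite (out_arcs G v) \<Longrightarrow> out_arcs G v \<noteq> {}
    \<Longrightarrow> mon [Vertex v] \<approx> (\<Sum>e\<in>out_arcs G v. mon [Edge e, Ghost e])"
  using relators_null[OF lpa_relators.CK2[of v G]] by (simp add: eqv_def gen_eq_mon)

lemma vertex_edge_null:
  assumes "v \<in> verts G" "e \<in> arcs G" "v \<noteq> tail G e" shows "mon [Vertex v, Edge e] \<in> null"
proof -
  have "mon [Vertex v, Vertex (tail G e), Edge e] \<approx> mon [Vertex v, Edge e]"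
    using assms by (intro eqv_Cons tail_edge) auto
  moreover have "mon [Vertex v, Vertex (tail G e), Edge e] \<in> null"
    using null_append[OF vertex_vertex_null, of v "tail G e" "[Edge e]"] assms by simp
  ultimately show ?thesis using eqv_null by blast
qed

lemma edge_vertex_null:
  assumes "v \<in> verts G" "e \<in> arcs G" "v \<noteq> head G e" shows "mon [Edge e, Vertex v] \<in> null"
proof -
  have "mon [Edge e, Vertex (head G e), Vertex v] \<approx> mon [Edge e, Vertex v]"
    using eqv_append[OF edge_head, of e "[Vertex v]"] assms by simp
  moreover have "mon [Edge e, Vertex (head G e), Vertex v] \<in> null"
    using assms by (intro null_Cons vertex_vertex_null) auto
  ultimately show ?thesis using eqv_null by blast
qed

lemma ghost_vertex_null:
  assumes "v \<in> verts G" "e \<in> arcs G" "v \<noteq> tail G e" shows "mon [Ghost e, Vertex v] \<in> null"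
proof -
  have "mon [Ghost e, Vertex (tail G e), Vertex v] \<approx> mon [Ghost e, Vertex v]"
    using eqv_append[OF ghost_tail, of e "[Vertex v]"] assms by simp
  moreover have "mon [Ghost e, Vertex (tail G e), Vertex v] \<in> null"
    using assms by (intro null_Cons vertex_vertex_null) auto
  ultimately show ?thesis using eqv_null by blast
qed


section \<open>Normal forms of words\<close>

text \<open>
  For paths \<open>\<alpha>\<close> and \<open>\<beta>\<close> with range \<open>c\<close>, the word of the element \<open>\<alpha>\<beta>\<^sup>*\<close>.  The vertex in the
  middle makes the word nonempty and makes sense of trivial paths.
\<close>

definition nf :: "'e list \<Rightarrow> 'v \<Rightarrow> 'e list \<Rightarrow> ('v, 'e) lpa_gen list"
  where "nf \<alpha> c \<beta> = map Edge \<alpha> @ Vertex c # map Ghost (rev \<beta>)"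

lemma nf_gens: "awalk a \<alpha> c \<Longrightarrow> awalk b \<beta> c \<Longrightarrow> set (nf \<alpha> c \<beta>) \<subseteq> lpa_gens G"
  by (auto simp: nf_def awalk_def awalk_last_in_verts)

lemma nf_simps [simp]:
  "nf (e # \<alpha>) c \<beta> = Edge e # nf \<alpha> c \<beta>"
  "nf \<alpha> c (e # \<beta>) = nf \<alpha> c \<beta> @ [Ghost e]"
  by (simp_all add: nf_def)

lemma nf_source:
  assumes "awalk a \<alpha> c" "awalk b \<beta> c"
  shows "mon (Vertex a # nf \<alpha> c \<beta>) \<approx> mon (nf \<alpha> c \<beta>)"
proof (cases \<alpha>)
  case Nil
  then show ?thesis
    using assms eqv_append[OF vertex_vertex, of c "map Ghost (rev \<beta>)"] nf_gens[OF assms]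
    by (auto simp: nf_def awalk_Nil_iff)
next
  case (Cons e \<gamma>)
  then show ?thesis
    using assms eqv_append[OF tail_edge, of e "nf \<gamma> c \<beta>"] nf_gens[of _ \<gamma> c b \<beta>]
    by (auto simp: awalk_Cons_iff)
qed

lemma nf_range:
  assumes "awalk a \<alpha> c" "awalk b \<beta> c"
  shows "mon (nf \<alpha> c \<beta> @ [Vertex b]) \<approx> mon (nf \<alpha> c \<beta>)"
proof (cases \<beta>)
  case Nil
  then show ?thesis
    using assms eqv_context[OF vertex_vertex, of c "map Edge \<alpha>" "[]"] nf_gens[OF assms]
    by (auto simp: nf_def awalk_Nil_iff)
next
  case (Cons e \<gamma>)
  then show ?thesis
    using assms eqv_context[OF ghost_tail, of e "nf \<alpha> c \<gamma>" "[]"] nf_gens[of a \<alpha> c _ \<gamma>]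
    by (auto simp: awalk_Cons_iff)
qed

lemma nf_vertex_null:
  assumes w: "awalk a \<alpha> c" "awalk b \<beta> c" and v: "v \<in> verts G" "v \<noteq> a"
  shows "mon (Vertex v # nf \<alpha> c \<beta>) \<in> null"
proof -
  have "mon (Vertex v # Vertex a # nf \<alpha> c \<beta>) \<approx> mon (Vertex v # nf \<alpha> c \<beta>)"
    using v by (intro eqv_Cons nf_source[OF w]) auto
  moreover have "mon (Vertex v # Vertex a # nf \<alpha> c \<beta>) \<in> null"
    using null_append[OF vertex_vertex_null, of v a "nf \<alpha> c \<beta>"] v w nf_gens[OF w]
    by (auto simp: awalk_hd_in_verts)
  ultimately show ?thesis using eqv_null by blast
qed

lemma nf_vertex_null_right:
  assumes w: "awalk a \<alpha> c" "awalk b \<beta> c" and v: "v \<in> verts G" "v \<noteq> b"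
  shows "mon (nf \<alpha> c \<beta> @ [Vertex v]) \<in> null"
proof -
  have "mon (nf \<alpha> c \<beta> @ [Vertex b, Vertex v]) \<approx> mon (nf \<alpha> c \<beta> @ [Vertex v])"
    using eqv_append[OF nf_range[OF w], of "[Vertex v]"] v by simp
  moreover have "mon (nf \<alpha> c \<beta> @ [Vertex b, Vertex v]) \<in> null"
    using null_context[OF vertex_vertex_null, of b v "nf \<alpha> c \<beta>" "[]"] v w nf_gens[OF w]
    by (auto simp: awalk_hd_in_verts)
  ultimately show ?thesis using eqv_null by blast
qed

text \<open>The degree that makes the Leavitt path algebra a graded algebra.\<close>

fun letter_degree :: "('v, 'e) lpa_gen \<Rightarrow> int" where
  "letter_degree (Vertex v) = 0"
| "letter_degree (Edge e) = 1"
| "letter_degree (Ghost e) = -1"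

text \<open>The degree of a word is the sum of the degrees of its letters.\<close>

definition deg :: "('v, 'e) lpa_gen word \<Rightarrow> int"
  where "deg w = sum_list (map letter_degree (letters w))"

lemma deg_plus: "deg (u + v) = deg u + deg v"
  by (simp add: deg_def plus_word_def)

lemma deg_Word [simp]:
  "deg (Word []) = 0" "deg (Word (x # w)) = letter_degree x + deg (Word w)"
  "deg (Word (u @ w)) = deg (Word u) + deg (Word w)"
  by (simp_all add: deg_def)

lemma deg_nf [simp]: "deg (Word (nf \<alpha> c \<beta>)) = int (length \<alpha>) - int (length \<beta>)"
proof -
  have "deg (Word (map Edge \<alpha>)) = int (length \<alpha>)" by (induction \<alpha>) auto
  moreover have "deg (Word (map Ghost \<beta>)) = - int (length \<beta>)" for \<beta> by (induction \<beta>) auto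
  ultimately show ?thesis by (simp add: nf_def del: rev_map)
qed

text \<open>
  The word \<open>w\<close> is zero in the Leavitt path algebra, or equal there to a normal form of the same
  degree.
\<close>

definition normalizable :: "('v, 'e) lpa_gen list \<Rightarrow> bool" where
  "normalizable w \<longleftrightarrow> mon w \<in> null \<or> (\<exists>a \<alpha> c b \<beta>. awalk a \<alpha> c \<and> awalk b \<beta> c
    \<and> deg (Word w) = int (length \<alpha>) - int (length \<beta>) \<and> mon w \<approx> mon (nf \<alpha> c \<beta>))"

lemma normalizableI:
  "awalk a \<alpha> c \<Longrightarrow> awalk b \<beta> c \<Longrightarrow> mon w \<approx> mon (nf \<alpha> c \<beta>)
    \<Longrightarrow> deg (Word w) = int (length \<alpha>) - int (length \<beta>) \<Longrightarrow> normalizable w"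
  unfolding normalizable_def by blast

lemma normalizable_Cons_nf:
  assumes w: "awalk a \<alpha> c" "awalk b \<beta> c" and x: "x \<in> lpa_gens G"
  shows "normalizable (x # nf \<alpha> c \<beta>)"
proof (cases x)
  case (Vertex v)
  show ?thesis
  proof (cases "v = a")
    case True
    then show ?thesis using nf_source[OF w] Vertex by (auto intro: normalizableI[OF w])
  next
    case False
    then show ?thesis using nf_vertex_null[OF w] Vertex x by (auto simp: normalizable_def)
  qed
next
  case (Edge e)
  then have e: "e \<in> arcs G" using x by simp
  show ?thesis
  proof (cases "head G e = a")
    case True
    with w e have "awalk (tail G e) (e # \<alpha>) c" by (simp add: awalk_Cons_iff)
    then show ?thesis using w(2) Edge by (auto intro: normalizableI)
  next
    case False
    have "mon (Edge e # Vertex a # nf \<alpha> c \<beta>) \<approx> mon (Edge e # nf \<alpha> c \<beta>)"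
      using e by (intro eqv_Cons nf_source[OF w]) auto
    moreover have "mon (Edge e # Vertex a # nf \<alpha> c \<beta>) \<in> null"
      using null_append[OF edge_vertex_null, of a e "nf \<alpha> c \<beta>"] e False w nf_gens[OF w]
      by (auto simp: awalk_hd_in_verts)
    ultimately show ?thesis using eqv_null Edge unfolding normalizable_def by blast
  qed
next
  case (Ghost e)
  then have e: "e \<in> arcs G" using x by simp
  show ?thesis
  proof (cases \<alpha>)
    case Nil
    then have c: "c \<in> verts G" "a = c" using w by (auto simp: awalk_Nil_iff)
    have g: "set (map Ghost (rev \<beta>)) \<subseteq> lpa_gens G" using w by (auto simp: awalk_def)
    show ?thesis
    proof (cases "c = tail G e")
      case True
      have wb: "awalk b (\<beta> @ [e]) (head G e)" "awalk (head G e) [] (head G e)"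
        using w e True by (auto simp: awalk_simps)
      have "mon (Ghost e # nf [] c \<beta>) \<approx> mon (Ghost e # map Ghost (rev \<beta>))"
        using eqv_append[OF ghost_tail[OF e] g] True by (simp add: nf_def)
      also have "mon (Ghost e # map Ghost (rev \<beta>)) \<approx> mon (nf [] (head G e) (\<beta> @ [e]))"
        using eqv_sym[OF eqv_append[OF head_ghost[OF e] g]] by (simp add: nf_def)
      finally show ?thesis
        using Ghost Nil by (intro normalizableI[OF wb(2,1)]) auto
    next
      case False
      then show ?thesis
        using null_append[OF ghost_vertex_null g, of c e] c e Nil Ghost
        by (auto simp: normalizable_def nf_def)
    qed
  next
    case (Cons f \<gamma>)
    then have f: "f \<in> arcs G" and \<gamma>: "awalk (head G f) \<gamma> c" using w by (auto simp: awalk_Cons_iff)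
    note g = nf_gens[OF \<gamma> w(2)]
    show ?thesis
    proof (cases "e = f")
      case True
      have "mon (Ghost e # nf \<alpha> c \<beta>) \<approx> mon (Vertex (head G f) # nf \<gamma> c \<beta>)"
        using eqv_append[OF ghost_edge[OF e] g] True Cons by simp
      also have "\<dots> \<approx> mon (nf \<gamma> c \<beta>)" by (rule nf_source[OF \<gamma> w(2)])
      finally show ?thesis using Ghost Cons by (intro normalizableI[OF \<gamma> w(2)]) auto
    next
      case False
      then show ?thesis
        using null_append[OF ghost_edge_null g, of e f] e f Cons Ghost
        by (auto simp: normalizable_def)
    qed
  qed
qed

lemma normalizable:
  assumes "w \<noteq> []" "set w \<subseteq> lpa_gens G"
  shows "normalizable w"
  using assms
proof (induction w rule: list_nonempty_induct)
  case (single x)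
  then have x: "x \<in> lpa_gens G" by simp
  \<comment> \<open>A vertex \<open>v\<close> with \<open>x = x v\<close> reduces a single letter to the multiplication of the normal
    form \<open>v\<close> by \<open>x\<close>.\<close>
  define v where "v = (case x of Vertex v \<Rightarrow> v | Edge e \<Rightarrow> head G e | Ghost e \<Rightarrow> tail G e)"
  have "mon [x] \<approx> mon (x # nf [] v [])" "v \<in> verts G"
    using x by (cases x; auto simp: v_def nf_def intro!: eqv_sym[OF vertex_vertex] eqv_sym[OF edge_head] eqv_sym[OF ghost_tail])+
  moreover from this have "normalizable (x # nf [] v [])"
    using x by (intro normalizable_Cons_nf[of v _ _ v]) (auto simp: awalk_Nil_iff)
  moreover have "deg (Word [x]) = deg (Word (x # nf [] v []))" by (simp add: nf_def)
  ultimately show ?case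
    unfolding normalizable_def by (metis eqv_null eqv_trans)
next
  case (cons x w)
  then have x: "x \<in> lpa_gens G" and "normalizable w" by auto
  then consider "mon w \<in> null" | a \<alpha> c b \<beta> where "awalk a \<alpha> c" "awalk b \<beta> c"
    "deg (Word w) = int (length \<alpha>) - int (length \<beta>)" "mon w \<approx> mon (nf \<alpha> c \<beta>)"
    unfolding normalizable_def by blast
  then show ?case
  proof cases
    case 1
    then show ?thesis using null_Cons x by (simp add: normalizable_def)
  next
    case 2
    then have "mon (x # w) \<approx> mon (x # nf \<alpha> c \<beta>)" using x by (intro eqv_Cons) auto
    moreover have "normalizable (x # nf \<alpha> c \<beta>)" using normalizable_Cons_nf 2 x by blast
    moreover have "deg (Word (x # w)) = deg (Word (x # nf \<alpha> c \<beta>))" using 2 by simp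
    ultimately show ?thesis
      unfolding normalizable_def by (metis eqv_null eqv_trans)
  qed
qed


section \<open>The ideal of relations is homogeneous\<close>


lemma component_null:
  assumes "f \<in> null"
  shows "component deg n f \<in> null"
proof -
  have "\<forall>n. component deg n f \<in> null"
    using assms unfolding null_def
  proof (induction rule: algebra_ideal_gen_monomial_induct)
    case (incl f)
    have "\<exists>m. \<forall>w \<in> Poly_Mapping.keys f. deg w = m"
    proof -
      have diff: "\<forall>w\<in>Poly_Mapping.keys (g - h). deg w = m"
        if "\<forall>w\<in>Poly_Mapping.keys g. deg w = m" "\<forall>w\<in>Poly_Mapping.keys h. deg w = m"
        for g h :: "(('v, 'e) lpa_gen, 'k) free_alg" and m
        using keys_diff[of g h] that by blast
      have sum: "\<forall>w\<in>Poly_Mapping.keys (sum h A). deg w = m"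
        if "\<And>e. \<forall>w\<in>Poly_Mapping.keys (h e). deg w = m"
        for h :: "'e \<Rightarrow> (('v, 'e) lpa_gen, 'k) free_alg" and m A
        using keys_sum[of h A] that by blast
      show ?thesis
        using incl
      proof cases
        case (V v w)
        have "\<forall>w\<in>Poly_Mapping.keys f. deg w = 0"
          unfolding V(1) gen_eq_mon mon_mult by (intro diff) (auto simp: mon_def)
        then show ?thesis ..
      next
        case (E1_source e)
        have "\<forall>w\<in>Poly_Mapping.keys f. deg w = 1"
          unfolding E1_source(1) gen_eq_mon mon_mult by (intro diff) (auto simp: mon_def)
        then show ?thesis ..
      next
        case (E1_range e)
        have "\<forall>w\<in>Poly_Mapping.keys f. deg w = 1"
          unfolding E1_range(1) gen_eq_mon mon_mult by (intro diff) (auto simp: mon_def)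
        then show ?thesis ..
      next
        case (E2_range e)
        have "\<forall>w\<in>Poly_Mapping.keys f. deg w = -1"
          unfolding E2_range(1) gen_eq_mon mon_mult by (intro diff) (auto simp: mon_def)
        then show ?thesis ..
      next
        case (E2_source e)
        have "\<forall>w\<in>Poly_Mapping.keys f. deg w = -1"
          unfolding E2_source(1) gen_eq_mon mon_mult by (intro diff) (auto simp: mon_def)
        then show ?thesis ..
      next
        case (CK1 e e')
        have "\<forall>w\<in>Poly_Mapping.keys f. deg w = 0"
          unfolding CK1(1) gen_eq_mon mon_mult by (intro diff) (auto simp: mon_def)
        then show ?thesis ..
      next
        case (CK2 v)
        have "\<forall>w\<in>Poly_Mapping.keys f. deg w = 0"
          unfolding CK2(1) gen_eq_mon mon_mult by (intro diff sum) (auto simp: mon_def)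
        then show ?thesis ..
      qed
    qed
    then show ?case
      using incl by (auto simp: component_homogeneous algebra_ideal_gen.incl algebra_ideal_gen.zero)
  next
    case (left f w c)
    show ?case
    proof
      fix n
      have "scal c * (mon w * component deg (n - deg (Word w)) f) \<in> null"
        using left by (intro null_scal mon_mult_null) (auto simp: null_def)
      then show "component deg n (Poly_Mapping.single (Word w) c * f) \<in> algebra_ideal_gen (lpa_gens G) (lpa_relators G)"
        by (simp add: null_def component_single_mult[OF deg_plus] scal_mon mult.assoc[symmetric])
    qed
  next
    case (right f w c)
    show ?case
    proof
      fix n
      have "scal c * (component deg (n - deg (Word w)) f * mon w) \<in> null"
        using right by (intro null_scal null_mult_mon) (auto simp: null_def)
      then show "component deg n (f * Poly_Mapping.single (Word w) c) \<in> algebra_ideal_gen (lpa_gens G) (lpa_relators G)"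
        by (simp add: null_def component_mult_single[OF deg_plus] mult_scal_left[symmetric] scal_mon)
    qed
  qed (auto simp: component_add algebra_ideal_gen.zero algebra_ideal_gen.add)
  then show ?thesis ..
qed


section \<open>Vertices are nonzero\<close>

text \<open>
  Partial action of the generators on finite paths, given as pairs of a source and a list of
  edges: a vertex fixes the paths that start there, an edge prepends itself, a ghost edge removes
  the corresponding first edge.
\<close>

fun act :: "('v, 'e) lpa_gen \<Rightarrow> 'v \<times> 'e list \<Rightarrow> ('v \<times> 'e list) option" where
  "act (Vertex v) (u, p) = (if u = v then Some (u, p) else None)"
| "act (Edge e) (u, p) = (if u = head G e then Some (tail G e, e # p) else None)"
| "act (Ghost e) (u, []) = None"
| "act (Ghost e) (u, f # p) = (if e = f then Some (head G e, p) else None)"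

text \<open>The partial action of words; the last letter acts first.\<close>

primrec act_word :: "('v, 'e) lpa_gen list \<Rightarrow> 'v \<times> 'e list \<Rightarrow> ('v \<times> 'e list) option" where
  "act_word [] x = Some x"
| "act_word (g # w) x = Option.bind (act_word w x) (act g)"

lemma act_word_append: "act_word (u @ w) x = Option.bind (act_word w x) (act_word u)"
  by (induction u) (auto split: Option.bind_split)

text \<open>
  The partial action extends linearly to an action of the free algebra on the vector space of
  combinations of paths.  A function \<open>\<phi>\<close> with \<open>\<phi> None = 0\<close> stands for a linear functional on
  this space, and \<open>coord f x \<phi>\<close> is its value at the result of applying \<open>f\<close> to the path \<open>x\<close>.
\<close>

definition coord :: "(('v, 'e) lpa_gen, 'k) free_alg \<Rightarrow> ('v \<times> 'e list) \<Rightarrow> (('v \<times> 'e list) option \<Rightarrow> 'k) \<Rightarrow> 'k"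
  where "coord f x \<phi> = (\<Sum>w\<in>Poly_Mapping.keys f. Poly_Mapping.lookup f w * \<phi> (act_word (letters w) x))"

lemma coord_superset:
  "finite A \<Longrightarrow> Poly_Mapping.keys f \<subseteq> A
    \<Longrightarrow> coord f x \<phi> = (\<Sum>w\<in>A. Poly_Mapping.lookup f w * \<phi> (act_word (letters w) x))"
  unfolding coord_def by (rule sum.mono_neutral_left) (auto simp: in_keys_iff)

lemma coord_add: "coord (f + g) x \<phi> = coord f x \<phi> + coord g x \<phi>"
  using keys_add[of f g]
  by (simp add: coord_superset[of "Poly_Mapping.keys f \<union> Poly_Mapping.keys g"] lookup_add
      distrib_right sum.distrib)

lemma coord_single [simp]: "coord (Poly_Mapping.single w c) x \<phi> = c * \<phi> (act_word (letters w) x)"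
  by (simp add: coord_def)

lemma coord_mon [simp]: "coord (mon w) x \<phi> = \<phi> (act_word w x)"
  by (simp add: mon_def)

lemma coord_zero [simp]: "coord 0 x \<phi> = 0"
  by (simp add: coord_def)

lemma coord_diff: "coord (f - g) x \<phi> = coord f x \<phi> - coord g x \<phi>"
  using coord_add[of "f - g" g x \<phi>] by simp

lemma coord_sum: "coord (sum h A) x \<phi> = (\<Sum>a\<in>A. coord (h a) x \<phi>)"
  by (induction A rule: infinite_finite_induct) (simp_all add: coord_add)

lemma coord_single_mult:
  "coord (Poly_Mapping.single (Word w) c * f) x \<phi> = c * coord f x (\<lambda>y. \<phi> (Option.bind y (act_word w)))"
  by (induction f rule: monomial_induct)
    (simp_all add: mult_single plus_word_def act_word_append coord_add algebra_simps)

lemma coord_mult_single: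
  "\<phi> None = 0 \<Longrightarrow> coord (f * Poly_Mapping.single (Word w) c) x \<phi>
    = (case act_word w x of None \<Rightarrow> 0 | Some y \<Rightarrow> c * coord f y \<phi>)"
  by (induction f rule: monomial_induct)
    (auto simp: mult_single plus_word_def act_word_append coord_add algebra_simps split: option.split)

text \<open>
  The paths that have at least \<open>n\<close> edges or end at a vertex to which (CK2) does not apply, that
  is, at a vertex that emits no or infinitely many edges.
\<close>

definition long_path :: "nat \<Rightarrow> 'v \<times> 'e list \<Rightarrow> bool"
  where "long_path n x \<longleftrightarrow> (\<exists>u. awalk (fst x) (snd x) u
    \<and> (n \<le> length (snd x) \<or> infinite (out_arcs G u) \<or> out_arcs G u = {}))"

lemma long_path_mono: "m \<le> n \<Longrightarrow> long_path n x \<Longrightarrow> long_path m x"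
  unfolding long_path_def by (meson order_trans)

lemma long_path_act:
  assumes "long_path (Suc n) x" "act g x = Some y" "g \<in> lpa_gens G"
  shows "long_path n y"
proof (cases g)
  case (Vertex v)
  then show ?thesis
    using assms long_path_mono[of n "Suc n" y] by (cases x) (auto split: if_splits)
next
  case (Edge e)
  then show ?thesis
    using assms by (cases x) (auto simp: long_path_def awalk_Cons_iff split: if_splits)
next
  case (Ghost e)
  then show ?thesis
    using assms by (cases x; cases "snd x") (auto simp: long_path_def awalk_Cons_iff split: if_splits)
qed

lemma long_path_act_word:
  assumes "long_path (n + length w) x" "act_word w x = Some y" "set w \<subseteq> lpa_gens G"
  shows "long_path n y"
  using assms
proof (induction w arbitrary: n y)
  case (Cons g w)
  then obtain z where z: "act_word w x = Some z" "act g z = Some y"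
    by (auto split: Option.bind_splits)
  from Cons.IH[of "Suc n" z] Cons.prems z have "long_path (Suc n) z" by simp
  then show ?case using long_path_act z Cons.prems by auto
qed simp

lemma long_path_exists:
  assumes "v \<in> verts G"
  shows "\<exists>p. long_path n (v, p)"
  using assms
proof (induction n arbitrary: v)
  case 0
  then show ?case by (intro exI[of _ "[]"]) (auto simp: long_path_def awalk_Nil_iff)
next
  case (Suc n)
  show ?case
  proof (cases "out_arcs G v = {}")
    case True
    then show ?thesis using Suc.prems by (intro exI[of _ "[]"]) (auto simp: long_path_def awalk_Nil_iff)
  next
    case False
    then obtain e where "e \<in> out_arcs G v" by blast
    then have e: "e \<in> arcs G" "tail G e = v" by auto
    with Suc.IH[of "head G e"] obtain p where "long_path n (head G e, p)" by auto
    then have "long_path (Suc n) (v, e # p)"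
      using e by (auto simp: long_path_def awalk_Cons_iff)
    then show ?thesis ..
  qed
qed

text \<open>
  Relation (CK2) at \<open>v\<close> fails only on the trivial path at \<open>v\<close>, so all relations hold on the paths
  of \<open>long_path 1\<close>.  Multiplication from the right by a word shortens paths by at most the length
  of the word, which explains why \<open>n\<close> depends on \<open>f\<close>.
\<close>

lemma null_kills_long_paths:
  assumes "f \<in> null"
  shows "\<exists>n. \<forall>x \<phi>. long_path n x \<longrightarrow> \<phi> None = 0 \<longrightarrow> coord f x \<phi> = 0"
  using assms unfolding null_def
proof (induction rule: algebra_ideal_gen_monomial_induct)
  case (incl f)
  have "coord f (u, p) \<phi> = 0" if "long_path 1 (u, p)" "\<phi> None = 0" for u p \<phi>
    using incl
  proof cases
    case (CK2 v)
    have *: "(\<Sum>e\<in>out_arcs G v. coord (gen (Edge e) * gen (Ghost e)) (u, p) \<phi>)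
      = (if u = v then \<phi> (Some (u, p)) else 0)"
    proof (cases p)
      case Nil
      then have "u \<noteq> v" using that CK2 by (auto simp: long_path_def awalk_Nil_iff)
      then show ?thesis using Nil that by (simp add: gen_eq_mon)
    next
      case (Cons e q)
      then have e: "e \<in> arcs G" "tail G e = u" using that by (auto simp: long_path_def awalk_Cons_iff)
      have "(\<Sum>f\<in>out_arcs G v. coord (gen (Edge f) * gen (Ghost f)) (u, p) \<phi>)
        = (\<Sum>f\<in>out_arcs G v. if f = e then \<phi> (Some (u, p)) else 0)"
        using that e Cons by (intro sum.cong) (auto simp: gen_eq_mon)
      also have "\<dots> = (if u = v then \<phi> (Some (u, p)) else 0)"
        using e CK2 by (simp add: sum.delta')
      finally show ?thesis .
    qed
    then show ?thesis
      using that by (simp add: CK2(1) coord_diff coord_sum gen_eq_mon)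
  next
    case (V v w)
    show ?thesis
      unfolding V(1) using that(2) by (cases p) (simp_all add: coord_diff gen_eq_mon)
  next
    case (E1_source e)
    show ?thesis
      unfolding E1_source(1) using that(2) by (cases p) (simp_all add: coord_diff gen_eq_mon)
  next
    case (E1_range e)
    show ?thesis
      unfolding E1_range(1) using that(2) by (cases p) (simp_all add: coord_diff gen_eq_mon)
  next
    case (E2_range e)
    show ?thesis
      unfolding E2_range(1) using that(2) by (cases p) (simp_all add: coord_diff gen_eq_mon)
  next
    case (E2_source e)
    show ?thesis
      unfolding E2_source(1) using that
      by (cases p) (auto simp: coord_diff gen_eq_mon long_path_def awalk_Cons_iff)
  next
    case (CK1 e e')
    show ?thesis
      unfolding CK1(1) using that(2) by (cases p) (simp_all add: coord_diff gen_eq_mon)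
  qed
  then show ?case by (intro exI[of _ 1]) auto
next
  case (add f g)
  then obtain m n where
    "\<And>x \<phi>. long_path m x \<Longrightarrow> \<phi> None = 0 \<Longrightarrow> coord f x \<phi> = 0"
    "\<And>x \<phi>. long_path n x \<Longrightarrow> \<phi> None = 0 \<Longrightarrow> coord g x \<phi> = 0" by blast
  then show ?case
    using long_path_mono[of m "max m n"] long_path_mono[of n "max m n"]
    by (intro exI[of _ "max m n"]) (auto simp: coord_add)
next
  case (left f w c)
  then obtain n where "\<And>x \<phi>. long_path n x \<Longrightarrow> \<phi> None = 0 \<Longrightarrow> coord f x \<phi> = 0" by blast
  then show ?case by (intro exI[of _ n]) (simp add: coord_single_mult)
next
  case (right f w c)
  then obtain n where n: "\<And>x \<phi>. long_path n x \<Longrightarrow> \<phi> None = 0 \<Longrightarrow> coord f x \<phi> = 0" by blast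
  show ?case
    using right long_path_act_word[of n w] n
    by (intro exI[of _ "n + length w"]) (auto simp: coord_mult_single split: option.split)
qed simp

lemma vertex_not_null:
  assumes "v \<in> verts G"
  shows "mon [Vertex v] \<notin> null"
proof
  assume "mon [Vertex v] \<in> null"
  then obtain n where n: "\<And>x \<phi>. long_path n x \<Longrightarrow> \<phi> None = 0 \<Longrightarrow> coord (mon [Vertex v]) x \<phi> = 0"
    using null_kills_long_paths by blast
  obtain p where p: "long_path n (v, p)" using long_path_exists assms by blast
  show False
    using n[OF p, of "\<lambda>y. if y = None then 0 else 1"] by simp
qed


section \<open>Reduction of homogeneous elements to vertices\<close>


lemma carrier_add: "f \<in> carrier free_ring \<Longrightarrow> g \<in> carrier free_ring \<Longrightarrow> f + g \<in> carrier free_ring"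
  using abelian_groupE(1)[OF nonunital_ring.axioms(1)[OF nonunital_ring_free], of f "lpa_gens G" g]
  by (simp add: free_nonunital_algebra_def)

text \<open>
  The elements that are represented by combinations of words \<open>\<alpha>\<beta>\<^sup>*\<close> of degree \<open>n\<close> in which
  \<open>\<beta>\<close> has length at most \<open>N\<close>.  For \<open>N = 0\<close> these are the combinations of paths of length \<open>n\<close>.
\<close>

inductive_set nf_span :: "int \<Rightarrow> nat \<Rightarrow> (('v, 'e) lpa_gen, 'k) free_alg set"
  for n :: int and N :: nat where
  null: "f \<in> null \<Longrightarrow> f \<in> nf_span n N"
| nf: "awalk a \<alpha> c \<Longrightarrow> awalk b \<beta> c \<Longrightarrow> int (length \<alpha>) - int (length \<beta>) = n \<Longrightarrow> length \<beta> \<le> N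
    \<Longrightarrow> scal k * mon (nf \<alpha> c \<beta>) \<in> nf_span n N"
| add: "f \<in> nf_span n N \<Longrightarrow> g \<in> nf_span n N \<Longrightarrow> f + g \<in> nf_span n N"

lemma nf_span_carrier: "f \<in> nf_span n N \<Longrightarrow> f \<in> carrier free_ring"
proof (induction rule: nf_span.induct)
  case (nf a \<alpha> c b \<beta> k)
  have "nf \<alpha> c \<beta> \<noteq> []" by (simp add: nf_def)
  then show ?case
    using nf_gens[OF nf(1,2)] by (simp add: scal_mon free_nonunital_algebra_def)
qed (auto intro: null_carrier carrier_add)

lemma nf_span_mono: "f \<in> nf_span n N \<Longrightarrow> N \<le> M \<Longrightarrow> f \<in> nf_span n M"
proof (induction rule: nf_span.induct)
  case (nf a \<alpha> c b \<beta> k)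
  then show ?case by (intro nf_span.nf) auto
qed (auto intro: nf_span.null nf_span.add)

lemma nf_span_eqv: "f \<approx> g \<Longrightarrow> g \<in> nf_span n N \<Longrightarrow> f \<in> nf_span n N"
  using nf_span.add[OF nf_span.null, of "f - g" g] by (simp add: eqv_def)

lemma component_nf_span:
  assumes "f \<in> carrier free_ring"
  shows "\<exists>N. component deg n f \<in> nf_span n N"
proof (rule monomial_induct[of f "\<lambda>f. \<exists>N. component deg n f \<in> nf_span n N"])
  fix w c assume "w \<in> Poly_Mapping.keys f"
  then have w: "letters w \<noteq> []" "set (letters w) \<subseteq> lpa_gens G"
    using assms by (auto simp: free_nonunital_algebra_def)
  have "\<exists>N. scal c * mon (letters w) \<in> nf_span (deg w) N"
    using normalizable[OF w] unfolding normalizable_def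
  proof (elim disjE exE conjE)
    assume "mon (letters w) \<in> null"
    then show ?thesis by (auto intro: nf_span.null null_scal)
  next
    fix a \<alpha> ca b \<beta>
    assume "awalk a \<alpha> ca" "awalk b \<beta> ca" and d: "deg (Word (letters w)) = int (length \<alpha>) - int (length \<beta>)"
      and e: "mon (letters w) \<approx> mon (nf \<alpha> ca \<beta>)"
    then have "scal c * mon (nf \<alpha> ca \<beta>) \<in> nf_span (deg w) (length \<beta>)"
      by (intro nf_span.nf) auto
    then show ?thesis using nf_span_eqv eqv_scal e by blast
  qed
  then show "\<exists>N. component deg n (Poly_Mapping.single w c) \<in> nf_span n N"
    using nf_span.null[OF null_zero] by (auto simp: component_single scal_mon)
next
  fix f g assume "\<exists>N. component deg n f \<in> nf_span n N" "\<exists>N. component deg n g \<in> nf_span n N"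
  then obtain M N where "component deg n f \<in> nf_span n M" "component deg n g \<in> nf_span n N" by blast
  then have "component deg n (f + g) \<in> nf_span n (max M N)"
    unfolding component_add by (intro nf_span.add) (auto elim: nf_span_mono)
  then show "\<exists>N. component deg n (f + g) \<in> nf_span n N" ..
qed (simp add: exI[of _ 0] nf_span.null[OF null_zero])

lemma nf_span_mult_vertex:
  "f \<in> nf_span n N \<Longrightarrow> v \<in> verts G \<Longrightarrow> f * mon [Vertex v] \<in> nf_span n N"
proof (induction rule: nf_span.induct)
  case (null f)
  then show ?case by (intro nf_span.null null_mult_mon) auto
next
  case (nf a \<alpha> c b \<beta> k)
  show ?case
  proof (cases "v = b")
    case True
    then have "scal k * mon (nf \<alpha> c \<beta>) * mon [Vertex v] \<approx> scal k * mon (nf \<alpha> c \<beta>)"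
      using eqv_scal[OF nf_range[OF nf(1,2)]] by (simp add: mult.assoc)
    then show ?thesis using nf_span_eqv nf_span.nf[OF nf(1-4)] by blast
  next
    case False
    then have "scal k * mon (nf \<alpha> c \<beta>) * mon [Vertex v] \<in> null"
      using nf_vertex_null_right[OF nf(1,2) nf(5)] by (auto simp: mult.assoc intro: null_scal)
    then show ?thesis by (rule nf_span.null)
  qed
qed (auto simp: distrib_right intro: nf_span.add)

lemma nf_span_mult_edge:
  "f \<in> nf_span n 0 \<Longrightarrow> e \<in> arcs G \<Longrightarrow> f * mon [Edge e] \<in> nf_span (n + 1) 0"
proof (induction rule: nf_span.induct)
  case (null f)
  then show ?case by (intro nf_span.null null_mult_mon) auto
next
  case (nf a \<alpha> c b \<beta> k)
  then have \<beta>: "\<beta> = []" and c: "c \<in> verts G" and e: "e \<in> arcs G"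
    and g: "set (map Edge \<alpha>) \<subseteq> lpa_gens G" and w: "awalk a \<alpha> c"
    by (auto simp: awalk_def awalk_last_in_verts)
  show ?case
  proof (cases "c = tail G e")
    case True
    have "mon (nf \<alpha> c [] @ [Edge e]) \<approx> mon (map Edge \<alpha> @ [Edge e])"
      using eqv_context[OF tail_edge[OF e] g, of "[]"] True by (simp add: nf_def)
    also have "\<dots> \<approx> mon (nf (\<alpha> @ [e]) (head G e) [])"
      using eqv_sym[OF eqv_context[OF edge_head[OF e] g, of "[]"]] by (simp add: nf_def)
    finally have "scal k * mon (nf \<alpha> c \<beta>) * mon [Edge e] \<approx> scal k * mon (nf (\<alpha> @ [e]) (head G e) [])"
      using \<beta> by (auto simp: mult.assoc intro: eqv_scal)
    moreover have "scal k * mon (nf (\<alpha> @ [e]) (head G e) []) \<in> nf_span (n + 1) 0"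
      using w e True nf(3) \<beta>
      by (intro nf_span.nf[of a _ _ "head G e"]) (auto simp: awalk_simps)
    ultimately show ?thesis by (rule nf_span_eqv)
  next
    case False
    have "mon (nf \<alpha> c \<beta> @ [Edge e]) \<in> null"
      using null_context[OF vertex_edge_null[OF c e False] g, of "[]"] \<beta> by (simp add: nf_def)
    then show ?thesis by (auto simp: mult.assoc intro: null_scal nf_span.null)
  qed
qed (auto simp: distrib_right intro: nf_span.add)

text \<open>For paths of the same length, \<open>\<alpha>\<^sup>*\<beta>\<close> is zero unless \<open>\<alpha> = \<beta>\<close>.\<close>

lemma paths_orthogonal:
  assumes "awalk a \<alpha> c" "awalk b \<beta> d" "length \<alpha> = length \<beta>"
  shows "mon (nf [] c \<alpha> @ nf \<beta> d []) \<approx> (if \<alpha> = \<beta> \<and> c = d then mon [Vertex c] else 0)"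
  using assms
proof (induction \<alpha> arbitrary: a b \<beta>)
  case Nil
  then show ?case
    using vertex_vertex[of c] vertex_vertex_null[of c d] by (auto simp: nf_def awalk_Nil_iff)
next
  case (Cons e \<gamma>)
  then obtain f \<delta> where \<beta>: "\<beta> = f # \<delta>" by (cases \<beta>) auto
  have e: "e \<in> arcs G" and f: "f \<in> arcs G" and \<gamma>: "awalk (head G e) \<gamma> c" and \<delta>: "awalk (head G f) \<delta> d"
    using Cons.prems \<beta> by (auto simp: awalk_Cons_iff)
  have g: "set (nf [] c \<gamma>) \<subseteq> lpa_gens G" "set (nf \<delta> d []) \<subseteq> lpa_gens G"
    using nf_gens[of c "[]" c _ \<gamma>] nf_gens[of _ \<delta> d d "[]"] \<gamma> \<delta>
    by (auto simp: awalk_Nil_iff awalk_last_in_verts)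
  show ?case
  proof (cases "e = f")
    case True
    have "mon (nf [] c (e # \<gamma>) @ nf \<beta> d []) \<approx> mon (nf [] c \<gamma> @ Vertex (head G e) # nf \<delta> d [])"
      using eqv_context[OF ghost_edge[OF e] g] \<beta> True by simp
    also have "\<dots> \<approx> mon (nf [] c \<gamma> @ nf \<delta> d [])"
      using eqv_context[OF nf_source[OF \<delta>, of d "[]"] g(1), of "[]"] True \<delta>
      by (simp add: awalk_Nil_iff awalk_last_in_verts)
    also have "\<dots> \<approx> (if \<gamma> = \<delta> \<and> c = d then mon [Vertex c] else 0)"
      using Cons.IH[OF \<gamma> \<delta>] Cons.prems \<beta> by simp
    finally show ?thesis using True \<beta> by simp
  next
    case False
    then show ?thesis
      using null_context[OF ghost_edge_null[OF e f False] g] \<beta> by simp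
  qed
qed

lemma nf_gens_path:
  assumes "awalk a \<alpha> c"
  shows "set (nf [] c \<alpha>) \<subseteq> lpa_gens G" "set (nf \<alpha> c []) \<subseteq> lpa_gens G"
  using assms nf_gens[of c "[]" c a \<alpha>] nf_gens[of a \<alpha> c c "[]"]
  by (auto simp: awalk_Nil_iff awalk_last_in_verts)

text \<open>
  Left multiplication by \<open>\<alpha>\<^sup>*\<close> extracts from a combination of paths of the same length the
  coefficient of \<open>\<alpha>\<close>.
\<close>

lemma path_coefficient:
  assumes "f \<in> nf_span (int (length \<alpha>)) 0" "awalk a \<alpha> c"
  shows "\<exists>k. mon (nf [] c \<alpha>) * f \<approx> scal k * mon [Vertex c]"
  using assms(1)
proof (induction rule: nf_span.induct)
  case (null f)
  then have "mon (nf [] c \<alpha>) * f \<approx> scal 0 * mon [Vertex c]"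
    using nf_gens_path(1)[OF assms(2)] by (simp add: mon_mult_null)
  then show ?case ..
next
  case (nf b \<beta> d b' \<beta>' k)
  then have "mon (nf [] c \<alpha>) * (scal k * mon (nf \<beta> d \<beta>'))
    \<approx> scal k * (if \<alpha> = \<beta> \<and> c = d then mon [Vertex c] else 0)"
    using eqv_scal[OF paths_orthogonal[OF assms(2) nf(1)], of k] by (simp add: mult_scal_left)
  then have "mon (nf [] c \<alpha>) * (scal k * mon (nf \<beta> d \<beta>'))
    \<approx> scal (if \<alpha> = \<beta> \<and> c = d then k else 0) * mon [Vertex c]"
    by (auto split: if_splits)
  then show ?case ..
next
  case (add f g)
  then obtain k l where "mon (nf [] c \<alpha>) * f \<approx> scal k * mon [Vertex c]"
    "mon (nf [] c \<alpha>) * g \<approx> scal l * mon [Vertex c]" by blast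
  from eqv_add[OF this] have "mon (nf [] c \<alpha>) * (f + g) \<approx> scal (k + l) * mon [Vertex c]"
    by (simp add: distrib_left distrib_right single_add)
  then show ?case ..
qed

text \<open>
  The elements \<open>\<alpha>\<alpha>\<^sup>*\<close>, for paths \<open>\<alpha>\<close> of length \<open>n\<close>, are orthogonal idempotents, and finitely many
  of them add up to a left unit for a given combination of such paths.  A path is recorded with
  its range \<open>c\<close>, which the list of edges does not determine for trivial paths.  The quantification
  over all larger sets \<open>Q\<close> allows for sums of two elements in the induction.
\<close>

lemma path_decomposition:
  assumes "f \<in> nf_span n 0"
  shows "\<exists>P. finite P \<and> P \<subseteq> {(\<alpha>, c). int (length \<alpha>) = n \<and> (\<exists>a. awalk a \<alpha> c)} \<and>
    (\<forall>Q. finite Q \<longrightarrow> P \<subseteq> Q \<longrightarrow> Q \<subseteq> {(\<alpha>, c). int (length \<alpha>) = n \<and> (\<exists>a. awalk a \<alpha> c)} \<longrightarrow>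
      f \<approx> (\<Sum>(\<alpha>, c)\<in>Q. mon (nf \<alpha> c []) * (mon (nf [] c \<alpha>) * f)))"
    (is "\<exists>P. finite P \<and> P \<subseteq> ?S \<and> (\<forall>Q. finite Q \<longrightarrow> P \<subseteq> Q \<longrightarrow> Q \<subseteq> ?S \<longrightarrow> f \<approx> ?sum Q f)")
  using assms
proof (induction rule: nf_span.induct)
  case (null f)
  have "?sum Q f \<in> null" if "Q \<subseteq> ?S" for Q
    using that null nf_gens_path by (intro null_sum) (force intro!: mon_mult_null)
  then have "f \<approx> ?sum Q f" if "Q \<subseteq> ?S" for Q
    using that null by (simp add: eqv_def null_diff)
  then show ?case by (intro exI[of _ "{}"]) auto
next
  case (nf a \<alpha> c b \<beta> k)
  then have \<beta>: "\<beta> = []" by simp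
  have "scal k * mon (nf \<alpha> c \<beta>) \<approx> ?sum Q (scal k * mon (nf \<alpha> c \<beta>))"
    if Q: "finite Q" "(\<alpha>, c) \<in> Q" "Q \<subseteq> ?S" for Q
  proof -
    have "(case p of (\<gamma>, d) \<Rightarrow> mon (nf \<gamma> d []) * (mon (nf [] d \<gamma>) * (scal k * mon (nf \<alpha> c \<beta>))))
      \<approx> (if p = (\<alpha>, c) then scal k * mon (nf \<alpha> c \<beta>) else 0)" if pQ: "p \<in> Q" for p
    proof -
      obtain \<gamma> d where p: "p = (\<gamma>, d)" by (cases p)
      then obtain a' where \<gamma>: "awalk a' \<gamma> d" "length \<gamma> = length \<alpha>"
        using pQ Q(3) nf(3) \<beta> by auto
      have "mon (nf \<gamma> d []) * (mon (nf [] d \<gamma>) * mon (nf \<alpha> c \<beta>))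
          \<approx> mon (nf \<gamma> d []) * (if \<gamma> = \<alpha> \<and> d = c then mon [Vertex d] else 0)"
        using paths_orthogonal[OF \<gamma>(1) nf(1) \<gamma>(2)] nf_gens_path[OF \<gamma>(1)] \<beta>
        by (intro eqv_mon_left) auto
      also have "\<dots> \<approx> (if p = (\<alpha>, c) then mon (nf \<alpha> c \<beta>) else 0)"
        using nf_range[of a \<alpha> c c "[]"] nf(1,2) p \<beta> by (auto simp: awalk_Nil_iff)
      finally have "scal k * (mon (nf \<gamma> d []) * (mon (nf [] d \<gamma>) * mon (nf \<alpha> c \<beta>)))
        \<approx> scal k * (if p = (\<alpha>, c) then mon (nf \<alpha> c \<beta>) else 0)"
        by (rule eqv_scal)
      then show ?thesis using p by (auto simp: mult_scal_left split: if_splits)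
    qed
    then have "?sum Q (scal k * mon (nf \<alpha> c \<beta>)) \<approx> (\<Sum>p\<in>Q. if p = (\<alpha>, c) then scal k * mon (nf \<alpha> c \<beta>) else 0)"
      by (rule eqv_sum)
    then show ?thesis using Q eqv_sym by simp
  qed
  then have "\<forall>Q. finite Q \<longrightarrow> {(\<alpha>, c)} \<subseteq> Q \<longrightarrow> Q \<subseteq> ?S
      \<longrightarrow> scal k * mon (nf \<alpha> c \<beta>) \<approx> ?sum Q (scal k * mon (nf \<alpha> c \<beta>))"
    by (intro allI impI) simp
  moreover have "{(\<alpha>, c)} \<subseteq> ?S" using nf(1,3) \<beta> by auto
  ultimately show ?case by (intro exI[of _ "{(\<alpha>, c)}"] conjI finite.intros)
next
  case (add f g)
  from add.IH(1) obtain P where P: "finite P" "P \<subseteq> ?S"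
      "\<forall>Q. finite Q \<longrightarrow> P \<subseteq> Q \<longrightarrow> Q \<subseteq> ?S \<longrightarrow> f \<approx> ?sum Q f" by (elim exE conjE)
  from add.IH(2) obtain P' where P': "finite P'" "P' \<subseteq> ?S"
      "\<forall>Q. finite Q \<longrightarrow> P' \<subseteq> Q \<longrightarrow> Q \<subseteq> ?S \<longrightarrow> g \<approx> ?sum Q g" by (elim exE conjE)
  have *: "?sum Q (f + g) = ?sum Q f + ?sum Q g" for Q
    by (simp add: distrib_left split_beta sum.distrib)
  have "f + g \<approx> ?sum Q (f + g)" if "finite Q" "P \<union> P' \<subseteq> Q" "Q \<subseteq> ?S" for Q
    using P(3)[rule_format, OF that(1) _ that(3)] P'(3)[rule_format, OF that(1) _ that(3)] that(2)
    unfolding * by (intro eqv_add) simp_all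
  then show ?case using P(1,2) P'(1,2) by (intro exI[of _ "P \<union> P'"] conjI allI impI) simp_all
qed

lemma path_coefficient_nonzero:
  assumes "f \<in> nf_span n 0" "f \<notin> null"
  obtains a \<alpha> c k where "awalk a \<alpha> c" "k \<noteq> 0" "mon (nf [] c \<alpha>) * f \<approx> scal k * mon [Vertex c]"
proof -
  obtain P where P: "finite P" "P \<subseteq> {(\<alpha>, c). int (length \<alpha>) = n \<and> (\<exists>a. awalk a \<alpha> c)}"
    "f \<approx> (\<Sum>(\<alpha>, c)\<in>P. mon (nf \<alpha> c []) * (mon (nf [] c \<alpha>) * f))"
    using path_decomposition[OF assms(1)] by blast
  then have "(\<Sum>(\<alpha>, c)\<in>P. mon (nf \<alpha> c []) * (mon (nf [] c \<alpha>) * f)) \<notin> null"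
    using assms(2) eqv_null by blast
  then obtain \<alpha> c where \<alpha>: "(\<alpha>, c) \<in> P" "mon (nf \<alpha> c []) * (mon (nf [] c \<alpha>) * f) \<notin> null"
    using null_sum[of P "\<lambda>(\<alpha>, c). mon (nf \<alpha> c []) * (mon (nf [] c \<alpha>) * f)"] by auto
  then obtain a where a: "awalk a \<alpha> c" and n: "n = int (length \<alpha>)" using P(2) by auto
  obtain k where k: "mon (nf [] c \<alpha>) * f \<approx> scal k * mon [Vertex c]"
    using path_coefficient assms(1) a n by blast
  have "k \<noteq> 0"
    using k \<alpha>(2) mon_mult_null nf_gens_path(2)[OF a] by auto
  with that a k show thesis by blast
qed

text \<open>Finitely many vertices add up to a right unit for a given element.\<close>

lemma vertex_decomposition:
  assumes "f \<in> nf_span n N"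
  shows "\<exists>V. finite V \<and> V \<subseteq> verts G \<and>
    (\<forall>W. finite W \<longrightarrow> V \<subseteq> W \<longrightarrow> W \<subseteq> verts G \<longrightarrow> f \<approx> (\<Sum>v\<in>W. f * mon [Vertex v]))"
  using assms
proof (induction rule: nf_span.induct)
  case (null f)
  then have "f \<approx> (\<Sum>v\<in>W. f * mon [Vertex v])" if "W \<subseteq> verts G" for W
    using that by (auto simp: eqv_def intro!: null_diff null_sum null_mult_mon)
  then show ?case by (intro exI[of _ "{}"]) auto
next
  case (nf a \<alpha> c b \<beta> k)
  have "scal k * mon (nf \<alpha> c \<beta>) \<approx> (\<Sum>v\<in>W. scal k * mon (nf \<alpha> c \<beta>) * mon [Vertex v])"
    if W: "finite W" "b \<in> W" "W \<subseteq> verts G" for W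
  proof -
    have "scal k * mon (nf \<alpha> c \<beta>) * mon [Vertex v] \<approx> (if v = b then scal k * mon (nf \<alpha> c \<beta>) else 0)"
      if "v \<in> W" for v
      using that W(3) nf_range[OF nf(1,2)] nf_vertex_null_right[OF nf(1,2), of v]
      by (auto simp: mult.assoc intro!: eqv_scal null_scal)
    then have "(\<Sum>v\<in>W. scal k * mon (nf \<alpha> c \<beta>) * mon [Vertex v])
      \<approx> (\<Sum>v\<in>W. if v = b then scal k * mon (nf \<alpha> c \<beta>) else 0)"
      by (rule eqv_sum)
    then show ?thesis using W eqv_sym by simp
  qed
  then show ?case using nf(2) by (intro exI[of _ "{b}"]) (auto simp: awalk_hd_in_verts)
next
  case (add f g)
  from add.IH(1) obtain V where V: "finite V" "V \<subseteq> verts G"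
      "\<forall>W. finite W \<longrightarrow> V \<subseteq> W \<longrightarrow> W \<subseteq> verts G \<longrightarrow> f \<approx> (\<Sum>v\<in>W. f * mon [Vertex v])"
    by (elim exE conjE)
  from add.IH(2) obtain V' where V': "finite V'" "V' \<subseteq> verts G"
      "\<forall>W. finite W \<longrightarrow> V' \<subseteq> W \<longrightarrow> W \<subseteq> verts G \<longrightarrow> g \<approx> (\<Sum>v\<in>W. g * mon [Vertex v])"
    by (elim exE conjE)
  have "f + g \<approx> (\<Sum>v\<in>W. (f + g) * mon [Vertex v])" if "finite W" "V \<union> V' \<subseteq> W" "W \<subseteq> verts G" for W
    using V(3)[rule_format, OF that(1) _ that(3)] V'(3)[rule_format, OF that(1) _ that(3)] that(2)
    unfolding distrib_right sum.distrib by (intro eqv_add) simp_all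
  then show ?case using V(1,2) V'(1,2) by (intro exI[of _ "V \<union> V'"] conjI allI impI) simp_all
qed

lemma vertex_mult_nonzero:
  assumes "f \<in> nf_span n N" "f \<notin> null"
  obtains v where "v \<in> verts G" "f * mon [Vertex v] \<notin> null"
proof -
  obtain V where "V \<subseteq> verts G" "f \<approx> (\<Sum>v\<in>V. f * mon [Vertex v])"
    using vertex_decomposition[OF assms(1)] by blast
  then show thesis
    using that null_sum[of V "\<lambda>v. f * mon [Vertex v]"] assms(2) eqv_null by blast
qed

lemma edge_not_null: "e \<in> arcs G \<Longrightarrow> mon [Edge e] \<notin> null"
  using null_Cons[of "[Edge e]" "Ghost e"] ghost_edge[of e] eqv_null vertex_not_null[of "head G e"]
  by auto

text \<open>Right multiplication by an edge is injective on combinations of paths that end at its source.\<close>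

lemma edge_cancel:
  assumes f: "f \<in> nf_span n 0" and e: "e \<in> arcs G" and 0: "f * mon [Edge e] \<in> null"
  shows "f * mon [Vertex (tail G e)] \<in> null"
proof (rule ccontr)
  let ?v = "Vertex (tail G e)"
  assume nz: "f * mon [?v] \<notin> null"
  have "f * mon [?v] \<in> nf_span n 0" using f e by (intro nf_span_mult_vertex) auto
  then obtain a \<alpha> c k where \<alpha>: "awalk a \<alpha> c" and k: "k \<noteq> 0"
    and *: "mon (nf [] c \<alpha>) * (f * mon [?v]) \<approx> scal k * mon [Vertex c]"
    using path_coefficient_nonzero nz by metis
  note g = nf_gens_path(1)[OF \<alpha>]
  have "mon [?v, Edge e] \<approx> mon [Edge e]" by (rule tail_edge[OF e])
  then have "(mon (nf [] c \<alpha>) * f) * mon [?v, Edge e] \<approx> (mon (nf [] c \<alpha>) * f) * mon [Edge e]"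
    using eqv_mon_left[OF eqv_carrier_left[OF _ nf_span_carrier[OF f]] g] by (simp add: mult.assoc)
  moreover have "(mon (nf [] c \<alpha>) * f) * mon [?v, Edge e] \<approx> scal k * mon [Vertex c, Edge e]"
    using eqv_mon_right[OF *, of "[Edge e]"] e by (simp add: mult.assoc)
  moreover have "(mon (nf [] c \<alpha>) * f) * mon [Edge e] \<in> null"
    using mon_mult_null[OF 0 g] by (simp add: mult.assoc)
  ultimately have "scal k * mon [Vertex c, Edge e] \<in> null" using eqv_null by metis
  then have ce: "mon [Vertex c, Edge e] \<in> null" using k by (simp add: null_scal_iff)
  have "c = tail G e"
  proof (rule ccontr)
    assume "c \<noteq> tail G e"
    then have "scal k * mon [Vertex c, ?v] \<in> null"
      using \<alpha> e by (intro null_scal vertex_vertex_null) (auto simp: awalk_last_in_verts)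
    moreover have "mon (nf [] c \<alpha>) * (f * mon [?v, ?v]) \<approx> scal k * mon [Vertex c, ?v]"
      using eqv_mon_right[OF *, of "[?v]"] e by (simp add: mult.assoc)
    moreover have "mon (nf [] c \<alpha>) * (f * mon [?v, ?v]) \<approx> mon (nf [] c \<alpha>) * (f * mon [?v])"
      using e by (intro eqv_mon_left[OF _ g] eqv_carrier_left[OF _ nf_span_carrier[OF f]] vertex_vertex) auto
    ultimately have "mon (nf [] c \<alpha>) * (f * mon [?v]) \<in> null"
      using eqv_null by blast
    with * have "scal k * mon [Vertex c] \<in> null" using eqv_null by blast
    then show False using k vertex_not_null \<alpha> by (auto simp: null_scal_iff awalk_last_in_verts)
  qed
  with ce show False using eqv_null[OF tail_edge[OF e]] edge_not_null[OF e] by simp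
qed

text \<open>Words are sorted by their last ghost edge; \<open>y\<close> collects those without ghost edges.\<close>

lemma ghost_decomposition:
  assumes "f \<in> nf_span n (Suc N)"
  shows "\<exists>y F X. y \<in> nf_span n 0 \<and> finite F \<and> F \<subseteq> arcs G \<and> (\<forall>e. X e \<in> nf_span (n + 1) N)
    \<and> (\<forall>e. e \<notin> F \<longrightarrow> X e = 0) \<and> f \<approx> y + (\<Sum>e\<in>F. X e * mon [Ghost e])"
  using assms
proof (induction rule: nf_span.induct)
  case (null f)
  then have "f \<approx> 0 + (\<Sum>e\<in>{}. (\<lambda>_. 0) e * mon [Ghost e])" by simp
  moreover have "0 \<in> nf_span m M" for m M by (rule nf_span.null) simp
  ultimately show ?case by (intro exI[of _ 0] exI[of _ "{}"] exI[of _ "\<lambda>_. 0"]) auto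
next
  case (nf a \<alpha> c b \<beta> k)
  show ?case
  proof (cases \<beta>)
    case Nil
    have "scal k * mon (nf \<alpha> c \<beta>) \<in> nf_span n 0"
      using nf Nil by (intro nf_span.nf) auto
    moreover have "0 \<in> nf_span m M" for m M by (rule nf_span.null) simp
    ultimately show ?thesis
      by (intro exI[of _ "scal k * mon (nf \<alpha> c \<beta>)"] exI[of _ "{}"] exI[of _ "\<lambda>_. 0"]) auto
  next
    case (Cons e \<gamma>)
    define X where "X f = (if f = e then scal k * mon (nf \<alpha> c \<gamma>) else 0)" for f
    have "scal k * mon (nf \<alpha> c \<gamma>) \<in> nf_span (n + 1) N"
      using nf Cons by (intro nf_span.nf) (auto simp: awalk_Cons_iff)
    then have X: "X f \<in> nf_span (n + 1) N" for f
      by (simp add: X_def nf_span.null)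
    have e: "e \<in> arcs G" using nf(2) Cons by (simp add: awalk_Cons_iff)
    have "scal k * mon (nf \<alpha> c \<beta>) \<approx> 0 + (\<Sum>f\<in>{e}. X f * mon [Ghost f])"
      using Cons by (simp add: X_def mult.assoc)
    moreover have "0 \<in> nf_span n 0" by (rule nf_span.null) simp
    moreover have "\<forall>f. f \<notin> {e} \<longrightarrow> X f = 0" by (simp add: X_def)
    ultimately show ?thesis
      by (intro exI[of _ 0] exI[of _ "{e}"] exI[of _ X] conjI allI X) (assumption | simp add: e)+
  qed
next
  case (add f f')
  from add.IH(1) obtain y F X where
    y: "y \<in> nf_span n 0" "finite F" "F \<subseteq> arcs G" "\<forall>e. X e \<in> nf_span (n + 1) N"
      "\<forall>e. e \<notin> F \<longrightarrow> X e = 0" "f \<approx> y + (\<Sum>e\<in>F. X e * mon [Ghost e])"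
    by (elim exE conjE)
  from add.IH(2) obtain y' F' X' where
    y': "y' \<in> nf_span n 0" "finite F'" "F' \<subseteq> arcs G" "\<forall>e. X' e \<in> nf_span (n + 1) N"
      "\<forall>e. e \<notin> F' \<longrightarrow> X' e = 0" "f' \<approx> y' + (\<Sum>e\<in>F'. X' e * mon [Ghost e])"
    by (elim exE conjE)
  have "(\<Sum>e\<in>F. X e * mon [Ghost e]) = (\<Sum>e\<in>F \<union> F'. X e * mon [Ghost e])"
    "(\<Sum>e\<in>F'. X' e * mon [Ghost e]) = (\<Sum>e\<in>F \<union> F'. X' e * mon [Ghost e])"
    using y y' by (auto intro!: sum.mono_neutral_left)
  then have "f + f' \<approx> (y + y') + (\<Sum>e\<in>F \<union> F'. (X e + X' e) * mon [Ghost e])"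
    using eqv_add[OF y(6) y'(6)] by (simp add: distrib_right sum.distrib algebra_simps)
  moreover have "X e + X' e \<in> nf_span (n + 1) N" for e using y y' by (intro nf_span.add) auto
  moreover have "y + y' \<in> nf_span n 0" using y y' by (intro nf_span.add)
  ultimately show ?case
    using y(2,3,5) y'(2,3,5)
    by (intro exI[of _ "y + y'"] exI[of _ "F \<union> F'"] exI[of _ "\<lambda>e. X e + X' e"] conjI allI impI) simp_all
qed

text \<open>
  Write the given element as \<open>x = y + (\<Sum>e\<in>F. X e e\<^sup>*)\<close>, where \<open>y\<close> is a combination of paths.
  If \<open>x e \<noteq> 0\<close> for some edge \<open>e\<close>, then \<open>x e\<close> involves shorter ghost paths and the induction
  hypothesis applies.  Otherwise \<open>X e e\<^sup>* = - y e e\<^sup>*\<close> for \<open>e \<in> F\<close>, so \<open>x v = y (v - \<Sum>e e\<^sup>*)\<close> for each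
  vertex \<open>v\<close>, where the sum ranges over the edges \<open>e \<in> F\<close> with source \<open>v\<close>.  Choose \<open>v\<close> with
  \<open>x v \<noteq> 0\<close>.  If \<open>v\<close> emitted edges, all of them in \<open>F\<close>, then \<open>x v = 0\<close> by (CK2).  If \<open>v\<close> emitted
  an edge \<open>f\<close> outside \<open>F\<close>, then \<open>y f = x f = 0\<close>, hence \<open>y v = 0\<close> and \<open>x v = 0\<close>.  So \<open>v\<close> is a sink
  and \<open>x v = y v\<close> is a combination of paths.
\<close>

lemma remove_ghosts:
  assumes "x \<in> nf_span n N" "x \<notin> null"
  shows "\<exists>w m. set w \<subseteq> lpa_gens G \<and> x * mon w \<in> nf_span m 0 \<and> x * mon w \<notin> null"
  using assms
proof (induction N arbitrary: n x)
  case 0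
  then show ?case by (intro exI[of _ "[]"]) auto
next
  case (Suc N)
  obtain y F X where y: "y \<in> nf_span n 0" and F: "finite F" "F \<subseteq> arcs G"
    and X: "\<And>e. X e \<in> nf_span (n + 1) N" and x: "x \<approx> y + (\<Sum>e\<in>F. X e * mon [Ghost e])"
    using ghost_decomposition[OF Suc.prems(1)] by blast
  note yc = nf_span_carrier[OF y] and Xc = nf_span_carrier[OF X]
  have xe: "x * mon [Edge e] \<approx> y * mon [Edge e] + (if e \<in> F then X e * mon [Vertex (head G e)] else 0)"
    if e: "e \<in> arcs G" for e
  proof -
    have "x * mon [Edge e] \<approx> y * mon [Edge e] + (\<Sum>f\<in>F. X f * mon [Ghost f, Edge e])"
      using eqv_mon_right[OF x, of "[Edge e]"] e by (simp add: distrib_right sum_distrib_right mult.assoc)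
    also have "\<dots> \<approx> y * mon [Edge e] + (\<Sum>f\<in>F. if f = e then X e * mon [Vertex (head G e)] else 0)"
    proof (intro eqv_add eqv_sum eqv_refl)
      fix f assume "f \<in> F"
      then show "X f * mon [Ghost f, Edge e] \<approx> (if f = e then X e * mon [Vertex (head G e)] else 0)"
        using F e ghost_edge[OF e] ghost_edge_null[of f e] Xc
        by (auto intro: eqv_carrier_left carrier_mult_null)
    qed
    finally show ?thesis using F(1) by simp
  qed
  show ?case
  proof (cases "\<exists>e\<in>arcs G. x * mon [Edge e] \<notin> null")
    case True
    then obtain e where e: "e \<in> arcs G" "x * mon [Edge e] \<notin> null" by blast
    have "y * mon [Edge e] + (if e \<in> F then X e * mon [Vertex (head G e)] else 0) \<in> nf_span (n + 1) N"
      using nf_span_mono[OF nf_span_mult_edge[OF y e(1)]] nf_span_mult_vertex[OF X, of "head G e" e] e(1)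
      by (auto intro: nf_span.add)
    then have "x * mon [Edge e] \<in> nf_span (n + 1) N" using nf_span_eqv xe e(1) by blast
    from Suc.IH[OF this e(2)] obtain w m where w: "set w \<subseteq> lpa_gens G"
      "x * mon (Edge e # w) \<in> nf_span m 0" "x * mon (Edge e # w) \<notin> null"
      by (auto simp: mult.assoc)
    then show ?thesis using e(1) by (intro exI[of _ "Edge e # w"] exI[of _ m]) auto
  next
    case False
    then have x0: "x * mon [Edge e] \<in> null" if "e \<in> arcs G" for e using that by blast
    have Xe: "X e * mon [Ghost e] \<approx> - (y * mon [Edge e, Ghost e])" if e: "e \<in> F" for e
    proof -
      have ea: "e \<in> arcs G" using e F by blast
      have "y * mon [Edge e] + X e * mon [Vertex (head G e)] \<in> null"
        using x0[OF ea] xe[OF ea] eqv_null e by fastforce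
      from null_mult_mon[OF this, of "[Ghost e]"]
      have "y * mon [Edge e, Ghost e] + X e * mon [Vertex (head G e), Ghost e] \<in> null"
        using ea by (simp add: distrib_right mult.assoc)
      moreover have "X e * mon [Vertex (head G e), Ghost e] \<approx> X e * mon [Ghost e]"
        using head_ghost[OF ea] Xc by (rule eqv_carrier_left)
      then have "y * mon [Edge e, Ghost e] + X e * mon [Vertex (head G e), Ghost e] \<approx> y * mon [Edge e, Ghost e] + X e * mon [Ghost e]"
        by (intro eqv_add) auto
      ultimately have "y * mon [Edge e, Ghost e] + X e * mon [Ghost e] \<in> null" using eqv_null by blast
      then show ?thesis by (simp add: eqv_def add.commute)
    qed
    obtain v where v: "v \<in> verts G" "x * mon [Vertex v] \<notin> null"
      using vertex_mult_nonzero Suc.prems by blast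
    let ?S = "F \<inter> out_arcs G v"
    have "x * mon [Vertex v] \<approx> (y + (\<Sum>e\<in>F. - (y * mon [Edge e, Ghost e]))) * mon [Vertex v]"
      using v by (intro eqv_mon_right eqv_trans[OF x] eqv_add eqv_sum Xe) auto
    also have "\<dots> = y * mon [Vertex v] - (\<Sum>e\<in>F. y * mon [Edge e, Ghost e, Vertex v])"
      by (simp add: distrib_right sum_distrib_right sum_negf mult.assoc left_diff_distrib)
    also have "\<dots> \<approx> y * mon [Vertex v] - (\<Sum>e\<in>F. if e \<in> out_arcs G v then y * mon [Edge e, Ghost e] else 0)"
    proof (intro eqv_diff eqv_sum eqv_refl)
      fix e assume "e \<in> F"
      then have e: "e \<in> arcs G" using F by blast
      then show "y * mon [Edge e, Ghost e, Vertex v] \<approx> (if e \<in> out_arcs G v then y * mon [Edge e, Ghost e] else 0)"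
        using eqv_Cons[OF ghost_tail[OF e], of "Edge e"] null_Cons[OF ghost_vertex_null[OF v(1) e], of "Edge e"]
        by (auto intro!: eqv_carrier_left carrier_mult_null yc)
    qed
    finally have xv: "x * mon [Vertex v] \<approx> y * mon [Vertex v] - (\<Sum>e\<in>?S. y * mon [Edge e, Ghost e])"
      using F(1) by (simp add: sum.inter_restrict)
    consider "out_arcs G v = {}" | "out_arcs G v \<noteq> {}" "out_arcs G v \<subseteq> F" | f where "f \<in> out_arcs G v" "f \<notin> F"
      by blast
    then have "x * mon [Vertex v] \<approx> y * mon [Vertex v]"
    proof cases
      case 1
      then show ?thesis using xv by simp
    next
      case 2
      then have "?S = out_arcs G v" "finite (out_arcs G v)" using F finite_subset by auto
      moreover from this have "y * mon [Vertex v] \<approx> y * (\<Sum>e\<in>out_arcs G v. mon [Edge e, Ghost e])"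
        using 2 v by (intro eqv_carrier_left vertex_sum_edges yc) auto
      ultimately have "y * mon [Vertex v] - (\<Sum>e\<in>?S. y * mon [Edge e, Ghost e]) \<in> null"
        by (simp add: sum_distrib_left eqv_def)
      then show ?thesis using xv v(2) eqv_null by blast
    next
      case 3
      then have f: "f \<in> arcs G" "tail G f = v" by auto
      have "y * mon [Edge f] \<in> null" using xe[OF f(1)] x0[OF f(1)] 3 eqv_null by fastforce
      then have yv: "y * mon [Vertex v] \<in> null" using edge_cancel[OF y f(1)] f(2) by simp
      have "y * mon [Edge e, Ghost e] \<in> null" if "e \<in> ?S" for e
      proof -
        have e: "e \<in> arcs G" "tail G e = v" using that by auto
        have "y * mon [Vertex v] * mon [Edge e, Ghost e] \<in> null"
          using e by (intro null_mult_mon[OF yv]) auto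
        moreover have "y * mon [Vertex v, Edge e, Ghost e] \<approx> y * mon [Edge e, Ghost e]"
          using eqv_append[OF tail_edge[OF e(1)], of "[Ghost e]"] e
          by (intro eqv_carrier_left yc) auto
        ultimately show ?thesis using eqv_null by (simp add: mult.assoc)
      qed
      then have "y * mon [Vertex v] - (\<Sum>e\<in>?S. y * mon [Edge e, Ghost e]) \<in> null"
        using yv by (intro null_diff null_sum)
      then show ?thesis using xv v(2) eqv_null by blast
    qed
    moreover have "y * mon [Vertex v] \<in> nf_span n 0" using nf_span_mult_vertex y v by blast
    ultimately show ?thesis
      using v nf_span_eqv by (intro exI[of _ "[Vertex v]"] exI[of _ n]) auto
  qed
qed

lemma homogeneous_reduction:
  assumes "x \<in> nf_span n N" "x \<notin> null"
  obtains u w v k where "set u \<subseteq> lpa_gens G" "set w \<subseteq> lpa_gens G" "v \<in> verts G" "k \<noteq> 0"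
    "mon u * x * mon w \<approx> scal k * mon [Vertex v]"
proof -
  obtain w m where w: "set w \<subseteq> lpa_gens G" "x * mon w \<in> nf_span m 0" "x * mon w \<notin> null"
    using remove_ghosts[OF assms] by blast
  obtain a \<alpha> c k where \<alpha>: "awalk a \<alpha> c" "k \<noteq> 0" "mon (nf [] c \<alpha>) * (x * mon w) \<approx> scal k * mon [Vertex c]"
    using path_coefficient_nonzero[OF w(2,3)] .
  then show thesis
    using that[of "nf [] c \<alpha>" w c k] nf_gens_path(1)[OF \<alpha>(1)] w(1)
    by (simp add: mult.assoc awalk_last_in_verts)
qed


section \<open>Primeness and condition (MT3)\<close>


lemma component_carrier: "f \<in> carrier free_ring \<Longrightarrow> component deg n f \<in> carrier free_ring"
  by (auto simp: free_nonunital_algebra_def keys_component)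

lemma top_component:
  assumes "f \<notin> null"
  obtains n where "component deg n f \<notin> null" "\<And>m. n < m \<Longrightarrow> component deg m f \<in> null"
proof -
  define D where "D = {n \<in> deg ` Poly_Mapping.keys f. component deg n f \<notin> null}"
  have "\<exists>n\<in>deg ` Poly_Mapping.keys f. component deg n f \<notin> null"
  proof (rule ccontr)
    assume "\<not> ?thesis"
    then have "(\<Sum>n\<in>deg ` Poly_Mapping.keys f. component deg n f) \<in> null"
      by (intro null_sum) blast
    then show False using assms sum_components[of f deg] by simp
  qed
  then have D: "finite D" "D \<noteq> {}" by (auto simp: D_def)
  have "component deg m f \<in> null" if "Max D < m" for m
  proof (cases "m \<in> deg ` Poly_Mapping.keys f")
    case True
    moreover have "m \<notin> D" using that Max_ge[OF D(1), of m] by auto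
    ultimately show ?thesis by (simp add: D_def)
  next
    case False
    then have "Poly_Mapping.keys (component deg m f) = {}" by (auto simp: keys_component)
    then show ?thesis by (metis null_zero poly_mapping_eqI lookup_zero in_keys_iff empty_iff)
  qed
  moreover have "component deg (Max D) f \<notin> null" using Max_in[OF D] by (simp add: D_def)
  ultimately show thesis using that by blast
qed

text \<open>
  The component of \<open>f w g\<close> in degree \<open>n + deg w + m\<close> is the sum of the products of the components
  \<open>i\<close> of \<open>f\<close> and \<open>j\<close> of \<open>g\<close> with \<open>i + j = n + m\<close>.  All of them except \<open>(i, j) = (n, m)\<close> have a
  factor above the highest nonzero degree.
\<close>

lemma top_components_mult:
  assumes f: "f \<in> carrier free_ring" and g: "g \<in> carrier free_ring" and w: "set w \<subseteq> lpa_gens G"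
    and 0: "f * mon w * g \<in> null"
    and n: "\<And>i. n < i \<Longrightarrow> component deg i f \<in> null"
    and m: "\<And>j. m < j \<Longrightarrow> component deg j g \<in> null"
  shows "component deg n f * mon w * component deg m g \<in> null"
proof -
  define A where "A = insert n (deg ` Poly_Mapping.keys f)"
  define B where "B = insert m (deg ` Poly_Mapping.keys g)"
  define t where "t = (\<lambda>(i, j). component deg i f * mon w * component deg j g)"
  have zero: "component deg i h = 0" if "i \<notin> deg ` Poly_Mapping.keys h"
    for i and h :: "(('v, 'e) lpa_gen, 'k) free_alg"
    using that by (intro poly_mapping_eqI) (auto simp: lookup_component when_def in_keys_iff)
  have fin: "finite A" "finite B" by (simp_all add: A_def B_def)
  have "f = (\<Sum>i\<in>A. component deg i f)" "g = (\<Sum>j\<in>B. component deg j g)"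
    using zero by (auto simp: A_def B_def sum.insert_if sum_components[symmetric])
  then have "f * mon w * g = (\<Sum>i\<in>A. component deg i f) * mon w * (\<Sum>j\<in>B. component deg j g)"
    by simp
  also have "\<dots> = (\<Sum>i\<in>A. component deg i f * mon w) * (\<Sum>j\<in>B. component deg j g)"
    by (simp only: sum_distrib_right)
  also have "\<dots> = sum t (A \<times> B)"
    by (simp only: sum_product sum.cartesian_product t_def)
  finally have fg: "f * mon w * g = sum t (A \<times> B)" .
  let ?N = "n + deg (Word w) + m"
  have ct: "component deg ?N (t (i, j)) = (if i + j = n + m then t (i, j) else 0)" for i j
  proof -
    have "deg u = i + deg (Word w) + j" if "u \<in> Poly_Mapping.keys (t (i, j))" for u
    proof -
      from that obtain a b where "a \<in> Poly_Mapping.keys (component deg i f * mon w)"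
        "b \<in> Poly_Mapping.keys (component deg j g)" "u = a + b"
        using keys_mult unfolding t_def by fastforce
      moreover from this obtain c where "c \<in> Poly_Mapping.keys (component deg i f)" "a = c + Word w"
        using keys_mult[of "component deg i f" "mon w"] by (fastforce simp: mon_def split: if_splits)
      ultimately show ?thesis by (auto simp: keys_component deg_plus)
    qed
    then show ?thesis by (subst component_homogeneous) auto
  qed
  have "component deg ?N (f * mon w * g) \<in> null"
    using 0 by (rule component_null)
  then have "(\<Sum>p\<in>A \<times> B. component deg ?N (t p)) \<in> null"
    by (simp add: fg component_sum)
  moreover have "(\<Sum>p\<in>A \<times> B. component deg ?N (t p))
    = component deg ?N (t (n, m)) + (\<Sum>p\<in>A \<times> B - {(n, m)}. component deg ?N (t p))"
    using fin by (intro sum.remove) (auto simp: A_def B_def)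
  moreover have "(\<Sum>p\<in>A \<times> B - {(n, m)}. component deg ?N (t p)) \<in> null"
  proof (rule null_sum)
    fix p assume "p \<in> A \<times> B - {(n, m)}"
    then obtain i j where p: "p = (i, j)" and ij: "(i, j) \<noteq> (n, m)" by auto
    have tp: "t p \<in> null" if "i + j = n + m"
    proof -
      consider "n < i" | "m < j" using \<open>i + j = n + m\<close> ij by fastforce
      then show ?thesis
      proof cases
        case 1
        then show ?thesis unfolding p t_def prod.case
          by (intro null_mult_carrier null_mult_mon n w component_carrier g)
      next
        case 2
        then show ?thesis unfolding p t_def prod.case mult.assoc
          by (intro carrier_mult_null mon_mult_null m w component_carrier f)
      qed
    qed
    then show "component deg ?N (t p) \<in> null" using p ct by auto
  qed
  ultimately have "component deg ?N (t (n, m)) \<in> null"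
    using null_diff by fastforce
  then show ?thesis using ct[of n m] by (simp add: t_def)
qed

text \<open>\<open>p q\<^sup>* \<noteq> 0\<close>, because \<open>p\<^sup>* (p q\<^sup>*) q = r\<close>.\<close>

lemma path_ghost_not_null:
  assumes p: "awalk v p r" and q: "awalk v' q r"
  shows "mon (nf p r q) \<notin> null"
proof
  assume 0: "mon (nf p r q) \<in> null"
  have r: "r \<in> verts G" using p by (rule awalk_last_in_verts)
  note gp = nf_gens_path[OF p] and gq = nf_gens_path[OF q]
  have "mon (nf p r [] @ nf [] r q) \<approx> mon (nf p r q)"
    using eqv_context[OF vertex_vertex[OF r], of "map Edge p" "map Ghost (rev q)"] gp gq
    by (simp add: nf_def)
  then have "mon (nf p r [] @ nf [] r q) \<in> null" using 0 eqv_null by blast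
  then have "mon (nf [] r p @ (nf p r [] @ nf [] r q) @ nf q r []) \<in> null"
    using gp gq by (intro null_context)
  moreover have "mon ((nf [] r p @ nf p r []) @ (nf [] r q @ nf q r [])) \<approx> mon ([Vertex r] @ (nf [] r q @ nf q r []))"
    using paths_orthogonal[OF p p] gq by (intro eqv_append) auto
  moreover have "mon ([Vertex r] @ (nf [] r q @ nf q r [])) \<approx> mon [Vertex r, Vertex r]"
    using eqv_Cons[of "nf [] r q @ nf q r []" "[Vertex r]" "Vertex r"] paths_orthogonal[OF q q] r by simp
  moreover have "mon [Vertex r, Vertex r] \<approx> mon [Vertex r]"
    using r by (rule vertex_vertex)
  ultimately have "mon [Vertex r] \<in> null"
    using eqv_null by (simp add: append_assoc)
  then show False using vertex_not_null r by blast
qed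

text \<open>
  Let \<open>k v\<close> and \<open>k' v'\<close> be the multiples of vertices to which the leading components \<open>F\<close>, \<open>G\<close> of
  \<open>f\<close> and \<open>g\<close> reduce.  The word \<open>w p q\<^sup>* u'\<close> between \<open>F\<close> and \<open>G\<close>, completed by the outer factors
  \<open>u\<close> and \<open>w'\<close>, turns \<open>F L G = 0\<close> into \<open>p q\<^sup>* = 0\<close>.
\<close>

lemma MT3_imp_prime_elements:
  assumes MT3: "MT3 G" and f: "f \<in> carrier free_ring" and g: "g \<in> carrier free_ring"
    and 0: "\<And>w. w \<noteq> [] \<Longrightarrow> set w \<subseteq> lpa_gens G \<Longrightarrow> f * mon w * g \<in> null"
  shows "f \<in> null \<or> g \<in> null"
proof (rule ccontr)
  assume "\<not> (f \<in> null \<or> g \<in> null)"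
  then have nz: "f \<notin> null" "g \<notin> null" by auto
  obtain n where n: "component deg n f \<notin> null" "\<And>i. n < i \<Longrightarrow> component deg i f \<in> null"
    using top_component[OF nz(1)] by blast
  obtain m where m: "component deg m g \<notin> null" "\<And>j. m < j \<Longrightarrow> component deg j g \<in> null"
    using top_component[OF nz(2)] by blast
  let ?F = "component deg n f" and ?G = "component deg m g"
  obtain N where "?F \<in> nf_span n N" using component_nf_span[OF f] by blast
  then obtain u w v k where F: "set u \<subseteq> lpa_gens G" "set w \<subseteq> lpa_gens G" "v \<in> verts G" "k \<noteq> 0"
    "mon u * ?F * mon w \<approx> scal k * mon [Vertex v]"
    using homogeneous_reduction n(1) by metis
  obtain N' where "?G \<in> nf_span m N'" using component_nf_span[OF g] by blast
  then obtain u' w' v' k' where G: "set u' \<subseteq> lpa_gens G" "set w' \<subseteq> lpa_gens G" "v' \<in> verts G" "k' \<noteq> 0"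
    "mon u' * ?G * mon w' \<approx> scal k' * mon [Vertex v']"
    using homogeneous_reduction m(1) by metis
  obtain r p q where p: "awalk v p r" and q: "awalk v' q r"
    using MT3 F(3) G(3) unfolding MT3_def connects_to_def by blast
  let ?z = "nf p r q"
  have z: "set ?z \<subseteq> lpa_gens G" "?z \<noteq> []" using nf_gens[OF p q] by (auto simp: nf_def)
  have "?F * mon (w @ ?z @ u') * ?G \<in> null"
    using f g F G z n(2) m(2) by (intro top_components_mult 0) auto
  then have "mon u * (?F * mon (w @ ?z @ u') * ?G) * mon w' \<in> null"
    using F G by (intro null_mult_mon mon_mult_null)
  then have 1: "(mon u * ?F * mon w) * mon ?z * (mon u' * ?G * mon w') \<in> null"
    by (simp add: mult.assoc flip: mon_mult)
  have cu: "mon u' * ?G * mon w' \<in> carrier free_ring"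
  proof -
    have "mon u' * ?G * mon w' = (mon u' * ?G * mon w' - scal k' * mon [Vertex v']) + scal k' * mon [Vertex v']"
      by simp
    also have "\<dots> \<in> carrier free_ring"
    proof (rule carrier_add)
      show "scal k' * mon [Vertex v'] \<in> carrier free_ring"
        using G(3) by (simp add: scal_mon free_nonunital_algebra_def)
    qed (use G(5) null_carrier in \<open>simp add: eqv_def\<close>)
    finally show ?thesis .
  qed
  have "(mon u * ?F * mon w) * mon ?z \<approx> (scal k * mon [Vertex v]) * mon ?z"
    using F z by (intro eqv_mon_right)
  also have "(scal k * mon [Vertex v]) * mon ?z = scal k * mon (Vertex v # ?z)"
    by (simp add: mult.assoc)
  also have "\<dots> \<approx> scal k * mon ?z" by (intro eqv_scal nf_source[OF p q])
  finally have "((mon u * ?F * mon w) * mon ?z) * (mon u' * ?G * mon w')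
    \<approx> (scal k * mon ?z) * (mon u' * ?G * mon w')"
    using null_mult_carrier[OF _ cu] by (simp add: eqv_def left_diff_distrib[symmetric])
  then have "(scal k * mon ?z) * (mon u' * ?G * mon w') \<in> null" using 1 eqv_null by blast
  then have "mon ?z * (mon u' * ?G * mon w') \<in> null"
    using F(4) by (simp add: mult.assoc null_scal_iff)
  moreover have "mon ?z * (mon u' * ?G * mon w') \<approx> mon ?z * (scal k' * mon [Vertex v'])"
    using G z by (intro eqv_mon_left)
  ultimately have "mon ?z * (scal k' * mon [Vertex v']) \<in> null" using eqv_null by blast
  then have "mon (?z @ [Vertex v']) \<in> null"
    using G(4) by (simp add: mult_scal_left null_scal_iff)
  then have "mon ?z \<in> null" using nf_range[OF p q] eqv_null by blast
  then show False using path_ghost_not_null[OF p q] by blast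
qed

lemma not_connected_imp_null:
  assumes v: "v \<in> verts G" and w: "w \<in> verts G"
    and nc: "\<And>u. u \<in> verts G \<Longrightarrow> \<not> (connects_to G v u \<and> connects_to G w u)"
    and h: "h \<in> carrier free_ring"
  shows "mon [Vertex v] * h * mon [Vertex w] \<in> null"
proof (rule monomial_induct[of h "\<lambda>h. mon [Vertex v] * h * mon [Vertex w] \<in> null"])
  fix x c assume "x \<in> Poly_Mapping.keys h"
  then have x: "letters x \<noteq> []" "set (letters x) \<subseteq> lpa_gens G"
    using h by (auto simp: free_nonunital_algebra_def)
  have "mon (Vertex v # letters x @ [Vertex w]) \<in> null"
    using normalizable[OF x] unfolding normalizable_def
  proof (elim disjE exE conjE)
    assume "mon (letters x) \<in> null"
    then show ?thesis using null_context[of "letters x" "[Vertex v]" "[Vertex w]"] v w by simp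
  next
    fix a \<alpha> c b \<beta>
    assume \<alpha>: "awalk a \<alpha> c" and \<beta>: "awalk b \<beta> c" and e: "mon (letters x) \<approx> mon (nf \<alpha> c \<beta>)"
    have "\<not> (v = a \<and> w = b)"
      using nc[of c] \<alpha> \<beta> by (auto simp: connects_to_def awalk_last_in_verts)
    then have "mon (Vertex v # nf \<alpha> c \<beta> @ [Vertex w]) \<in> null"
    proof (cases "v = a")
      case False
      then show ?thesis
        using null_append[OF nf_vertex_null[OF \<alpha> \<beta> v], of "[Vertex w]"] w by simp
    next
      case True
      with \<open>\<not> (v = a \<and> w = b)\<close> show ?thesis
        using null_Cons[OF nf_vertex_null_right[OF \<alpha> \<beta> w], of "Vertex v"] v by simp
    qed
    moreover have "mon (Vertex v # letters x @ [Vertex w]) \<approx> mon (Vertex v # nf \<alpha> c \<beta> @ [Vertex w])"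
      using eqv_context[OF e, of "[Vertex v]" "[Vertex w]"] v w by simp
    ultimately show ?thesis using eqv_null by blast
  qed
  then have "scal c * mon (Vertex v # letters x @ [Vertex w]) \<in> null" by (rule null_scal)
  moreover have "Poly_Mapping.single x c = scal c * mon (letters x)" by (simp add: scal_mon)
  ultimately show "mon [Vertex v] * Poly_Mapping.single x c * mon [Vertex w] \<in> null"
    by (simp add: mult_scal_left mult.assoc)
qed (auto simp: distrib_left distrib_right intro: null_add)

abbreviation lpa :: "(('v, 'e) lpa_gen, 'k) free_alg set ring"
  where "lpa \<equiv> leavitt_path_algebra TYPE('k) G"

text \<open>The class of an element of the free algebra in the Leavitt path algebra.\<close>

abbreviation coset :: "(('v, 'e) lpa_gen, 'k) free_alg \<Rightarrow> (('v, 'e) lpa_gen, 'k) free_alg set"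
  where "coset f \<equiv> null +>\<^bsub>free_ring\<^esub> f"

lemma lpa_simps:
  "\<zero>\<^bsub>lpa\<^esub> = null"
  "x \<in> carrier lpa \<longleftrightarrow> (\<exists>f\<in>carrier free_ring. x = coset f)"
  by (auto simp: leavitt_path_algebra_def null_def[symmetric] FactRing_def A_RCOSETS_def')

lemma coset_mult:
  "f \<in> carrier free_ring \<Longrightarrow> g \<in> carrier free_ring \<Longrightarrow> coset f \<otimes>\<^bsub>lpa\<^esub> coset g = coset (f * g)"
  using nonunital_ideal.rcoset_mult[OF null_ideal, of f g]
  by (simp add: leavitt_path_algebra_def null_def[symmetric] FactRing_def free_nonunital_algebra_def)

lemma coset_eq_null: "f \<in> carrier free_ring \<Longrightarrow> coset f = null \<longleftrightarrow> f \<in> null"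
  using abelian_subgroup.a_rcos_self[OF nonunital_ideal.abelian_subgroup[OF null_ideal], of f]
    abelian_subgroup.a_rcos_const[OF nonunital_ideal.abelian_subgroup[OF null_ideal], of f] by blast

lemma coset_cong:
  assumes "f \<approx> g" "g \<in> carrier free_ring"
  shows "coset f = coset g"
proof -
  have "f = (f - g) \<oplus>\<^bsub>free_ring\<^esub> g" by (simp add: free_nonunital_algebra_def)
  then have "f \<in> coset g" using assms(1) by (auto simp: a_r_coset_def' eqv_def)
  then show ?thesis
    using abelian_subgroup.a_repr_independence'[OF nonunital_ideal.abelian_subgroup[OF null_ideal]] assms(2)
    by blast
qed

lemma carrier_mult: "f \<in> carrier free_ring \<Longrightarrow> g \<in> carrier free_ring \<Longrightarrow> f * g \<in> carrier free_ring"
  using nonunital_ring.mult_closed[OF nonunital_ring_free, of f "lpa_gens G" g]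
  by (simp add: free_nonunital_algebra_def)

lemma prime_iff_MT3: "nonunital_prime_ring lpa \<longleftrightarrow> MT3 G"
proof
  assume prime: "nonunital_prime_ring lpa"
  show "MT3 G"
  proof (rule ccontr)
    assume "\<not> MT3 G"
    then obtain v w where v: "v \<in> verts G" and w: "w \<in> verts G"
      and nc: "\<And>u. u \<in> verts G \<Longrightarrow> \<not> (connects_to G v u \<and> connects_to G w u)"
      unfolding MT3_def by blast
    have c: "mon [Vertex v] \<in> carrier free_ring" "mon [Vertex w] \<in> carrier free_ring"
      using v w by (auto intro: mon_carrier)
    have "coset (mon [Vertex w] * mon [Vertex w]) = coset (mon [Vertex w])"
      using coset_cong[of "mon [Vertex w] * mon [Vertex w]" "mon [Vertex w]"] vertex_vertex[OF w] c by simp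
    then have idem: "coset (mon [Vertex w]) \<otimes>\<^bsub>lpa\<^esub> coset (mon [Vertex w]) = coset (mon [Vertex w])"
      using c by (simp add: coset_mult)
    have "coset (mon [Vertex v]) = \<zero>\<^bsub>lpa\<^esub> \<or> coset (mon [Vertex w]) = \<zero>\<^bsub>lpa\<^esub>"
    proof (rule nonunital_prime_ring.prime_elementwise[OF prime _ _ _ idem])
      fix r assume "r \<in> carrier lpa"
      then obtain h where h: "h \<in> carrier free_ring" "r = coset h" by (auto simp: lpa_simps)
      then show "coset (mon [Vertex v]) \<otimes>\<^bsub>lpa\<^esub> r \<otimes>\<^bsub>lpa\<^esub> coset (mon [Vertex w]) = \<zero>\<^bsub>lpa\<^esub>"
        using c not_connected_imp_null[OF v w nc h(1)]
        by (simp add: coset_mult carrier_mult lpa_simps coset_eq_null)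
    qed (use c in \<open>auto simp: lpa_simps\<close>)
    then show False
      using c v w vertex_not_null by (auto simp: lpa_simps coset_eq_null)
  qed
next
  assume MT3: "MT3 G"
  show "nonunital_prime_ring lpa"
  proof (rule nonunital_ring.prime_ring_if_elementwise)
    show "nonunital_ring lpa"
      by (rule nonunital_ring_leavitt_path_algebra) (rule wf_digraph_axioms)
    fix x y assume "x \<in> carrier lpa" "y \<in> carrier lpa"
      and 0: "\<And>r. r \<in> carrier lpa \<Longrightarrow> x \<otimes>\<^bsub>lpa\<^esub> r \<otimes>\<^bsub>lpa\<^esub> y = \<zero>\<^bsub>lpa\<^esub>"
    then obtain f g where f: "f \<in> carrier free_ring" "x = coset f"
      and g: "g \<in> carrier free_ring" "y = coset g" by (auto simp: lpa_simps)
    have "f * mon w * g \<in> null" if w: "w \<noteq> []" "set w \<subseteq> lpa_gens G" for w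
    proof -
      have "mon w \<in> carrier free_ring" using w by (rule mon_carrier)
      then show ?thesis
        using 0[of "coset (mon w)"] f g by (auto simp: lpa_simps coset_mult carrier_mult coset_eq_null)
    qed
    then have "f \<in> null \<or> g \<in> null" by (rule MT3_imp_prime_elements[OF MT3 f(1) g(1)])
    then show "x = \<zero>\<^bsub>lpa\<^esub> \<or> y = \<zero>\<^bsub>lpa\<^esub>" using f g by (auto simp: lpa_simps coset_eq_null)
  qed
qed

end

theorem theorem1p4:
  fixes E :: "('v, 'e) pre_digraph"
  assumes "wf_digraph E"
  shows "nonunital_prime_ring (leavitt_path_algebra TYPE('k::field) E) \<longleftrightarrow> MT3 E"
  using leavitt.prime_iff_MT3[OF leavitt.intro[OF assms]] .

end
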